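(* Fix an integer $d\ge 2$. There is a function $f_d:\mathbb{N}\to\mathbb{R}$ with $f_d(w)\to 0$ as $w\to\infty$ such that for every positive integer $w$, \[ \mathrm{olw}_R(w,d)\;\ge\;\Big(2-\frac{1}{d-1}-f_d(w)\Big)\binom{w+1}{2}. \] In words: no on-line algorithm partitions $d$-dimensional posets of width $w$, presented on-line via a realizer of cardinality $d$, into fewer than $(2-\frac{1}{d-1}-o(1))\binom{w+1}{2}$ chains.
   Context: On-line chain partitioning is a game between two players, Anna and Bertha. In each round Anna introduces a new point and Bertha irrevocably assigns it to a chain, equivalently gives it a color, so that each color class is a chain of the final poset. In the variant with a presented realizer of cardinality $d$, Anna maintains $d$ linear orders $L_1,\dots,L_d$ on the points introduced so far. In each round she inserts the new point into each $L_j$ and reveals all $d$ linear orders to Bertha. The poset presented is $P=L_1\cap\cdots\cap L_d$, and earlier relative positions never change. $\mathrm{olw}_R(w,d)$ is the largest integer $k$ such that Anna has a strategy of this kind forcing every on-line chain partitioning algorithm to use at least $k$ chains on a poset of width at most $w$. *)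

theory Defs
  imports Complex_Main "HOL-Library.Extended_Real"
begin

text \<open>
  Points are named \<open>0, 1, 2, \<dots>\<close> in the order in which Anna introduces them, so the position
  reached after \<open>n\<close> rounds is a list of \<open>d\<close> (reflexive) linear orders on \<open>{..<n}\<close>.
  Repetitions in the list are allowed; on a single point all linear orders coincide.
\<close>

definition realizer :: "nat \<Rightarrow> nat \<Rightarrow> nat rel list \<Rightarrow> bool" where
  "realizer d n Ls \<longleftrightarrow> length Ls = d \<and> (\<forall>L\<in>set Ls. linear_order_on {..<n} L)"

definition realized_poset :: "nat rel list \<Rightarrow> nat rel" where
  "realized_poset Ls = \<Inter> (set Ls)"

definition restrict_realizer :: "nat \<Rightarrow> nat rel list \<Rightarrow> nat rel list" where
  "restrict_realizer m Ls = map (\<lambda>L. Restr L {..<m}) Ls"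

definition antichains :: "nat set \<Rightarrow> nat rel \<Rightarrow> nat set set" where
  "antichains X P = {C. C \<subseteq> X \<and> (\<forall>x\<in>C. \<forall>y\<in>C. x \<noteq> y \<longrightarrow> (x, y) \<notin> P)}"

definition poset_width :: "nat set \<Rightarrow> nat rel \<Rightarrow> nat" where
  "poset_width X P = Max (card ` antichains X P)"

text \<open>
  An on-line algorithm \<open>A\<close> maps the current position to the color of the point introduced last.
  Because of the naming of the points, the current position determines all earlier ones, and
  hence also Bertha's own earlier answers.  The color of point \<open>x\<close> depends only on the position
  at the time \<open>x\<close> was introduced, i.e. on the restriction to the points \<open>0, \<dots>, x\<close>.
\<close>

definition online_color :: "(nat rel list \<Rightarrow> nat) \<Rightarrow> nat rel list \<Rightarrow> nat \<Rightarrow> nat" where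
  "online_color A Ls x = A (restrict_realizer (Suc x) Ls)"

definition online_chain_partitioner :: "nat \<Rightarrow> nat \<Rightarrow> (nat rel list \<Rightarrow> nat) \<Rightarrow> bool" where
  "online_chain_partitioner w d A \<longleftrightarrow>
     (\<forall>n Ls. realizer d n Ls \<and> poset_width {..<n} (realized_poset Ls) \<le> w \<longrightarrow>
        (\<forall>c. {x. x < n \<and> online_color A Ls x = c} \<in> Chains (realized_poset Ls)))"

text \<open>
  A strategy of Anna maps the list of colors given so far to the position after her next move.
  Since earlier relative positions never change, that position extends the previous one.
\<close>

definition anna_strategy :: "nat \<Rightarrow> (nat list \<Rightarrow> nat rel list) \<Rightarrow> bool" where
  "anna_strategy d S \<longleftrightarrow>
     (\<forall>cs. realizer d (Suc (length cs)) (S cs)) \<and>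
     (\<forall>cs c. restrict_realizer (Suc (length cs)) (S (cs @ [c])) = S cs)"

primrec play_colors :: "(nat list \<Rightarrow> nat rel list) \<Rightarrow> (nat rel list \<Rightarrow> nat) \<Rightarrow> nat \<Rightarrow> nat list" where
  "play_colors S A 0 = []"
| "play_colors S A (Suc n) = play_colors S A n @ [A (S (play_colors S A n))]"

text \<open>
  Anna may stop after any round of her choice; the poset presented up to then must have width at
  most \<open>w\<close>.  The position after round \<open>Suc n\<close> is \<open>S (play_colors S A n)\<close>.
\<close>

definition forces_chains ::
  "nat \<Rightarrow> nat \<Rightarrow> (nat list \<Rightarrow> nat rel list) \<Rightarrow> nat \<Rightarrow> bool" where
  "forces_chains w d S k \<longleftrightarrow>
     (\<forall>A. online_chain_partitioner w d A \<longrightarrow>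
        (\<exists>n. poset_width {..<Suc n} (realized_poset (S (play_colors S A n))) \<le> w \<and>
             k \<le> card (set (play_colors S A (Suc n)))))"

text \<open>
  The supremum is taken in \<^typ>\<open>enat\<close>, so that it is the largest such \<open>k\<close> whenever there
  is one and no boundedness result is presupposed.
\<close>

definition olw_R :: "nat \<Rightarrow> nat \<Rightarrow> enat" where
  "olw_R w d = Sup (enat ` {k. \<exists>S. anna_strategy d S \<and> forces_chains w d S k})"

end

theory Submission
  imports Defs
begin

text \<open>
  Anna's points are vectors in \<open>\<real>\<^sup>d\<close>, ordered coordinatewise; the \<open>j\<close>-th linear order compares the
  \<open>j\<close>-th coordinates.  Inside a box, Anna can force a chain with \<open>w\<close> colors in a corner of the box
  belonging to any prescribed order \<open>a\<close>, using width \<open>w\<close>, such that a smaller box remains that is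
  incomparable to this chain and above all other points (otherwise Bertha spends arbitrarily many
  colors).  Nesting this for the orders \<open>0, \<dots>, d - 2\<close> costs only \<open>O(d)\<close> colors per corner.
  On top of all this Anna plays the dual strategy for the order \<open>d - 1\<close>.  The color sets of the
  \<open>d - 1\<close> bottom chains are disjoint, so one of them shares at most a fraction \<open>1 / (d - 1)\<close> of
  the colors of the top chain.  The two chains form one chain with about \<open>(2 - 1 / (d - 1)) w\<close>
  colors, and Anna continues recursively with width \<open>w - 1\<close> in a box between bottom and top that is
  incomparable to this chain.  Summing up gives the factor \<open>w + 1 choose 2\<close>.
\<close>

section \<open>The coordinate model of the game\<close>

type_synonym vec = "nat \<Rightarrow> real"

definition below :: "nat \<Rightarrow> vec \<Rightarrow> vec \<Rightarrow> bool" where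
  "below d p q \<longleftrightarrow> (\<forall>j<d. p j < q j)"

definition comparable :: "nat \<Rightarrow> vec \<Rightarrow> vec \<Rightarrow> bool" where
  "comparable d p q \<longleftrightarrow> below d p q \<or> below d q p"

definition width_le :: "nat \<Rightarrow> vec set \<Rightarrow> nat \<Rightarrow> bool" where
  "width_le d X w \<longleftrightarrow>
     (\<forall>A\<subseteq>X. (\<forall>x\<in>A. \<forall>y\<in>A. x \<noteq> y \<longrightarrow> \<not> comparable d x y) \<longrightarrow> card A \<le> w)"

definition fresh :: "nat \<Rightarrow> (vec \<times> nat) list \<Rightarrow> vec \<Rightarrow> bool" where
  "fresh d st p \<longleftrightarrow> (\<forall>x\<in>set st. \<forall>j<d. p j \<noteq> fst x j)"

definition legal :: "nat \<Rightarrow> (vec \<times> nat) list \<Rightarrow> vec \<Rightarrow> nat \<Rightarrow> bool" where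
  "legal d st p c \<longleftrightarrow> (\<forall>x\<in>set st. snd x = c \<longrightarrow> comparable d p (fst x))"

definition valid :: "nat \<Rightarrow> (vec \<times> nat) list \<Rightarrow> bool" where
  "valid d st \<longleftrightarrow> (\<forall>x\<in>set st. \<forall>y\<in>set st.
     snd x = snd y \<longrightarrow> fst x = fst y \<or> comparable d (fst x) (fst y))"

text \<open>A position is a list of colored points, the most recent one first.\<close>

inductive force :: "nat \<Rightarrow> ((vec \<times> nat) list \<Rightarrow> bool) \<Rightarrow> (vec \<times> nat) list \<Rightarrow> bool"
  for d Q where
  stop: "Q st \<Longrightarrow> force d Q st"
| move: "fresh d st p \<Longrightarrow> (\<And>c. legal d st p c \<Longrightarrow> force d Q ((p, c) # st)) \<Longrightarrow> force d Q st"

lemma comparable_commute: "comparable d p q \<longleftrightarrow> comparable d q p"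
  unfolding comparable_def by (rule disj_commute)

lemma width_leI:
  "(\<And>A. A \<subseteq> X \<Longrightarrow> (\<And>x y. x \<in> A \<Longrightarrow> y \<in> A \<Longrightarrow> x \<noteq> y \<Longrightarrow> \<not> comparable d x y) \<Longrightarrow> card A \<le> w)
    \<Longrightarrow> width_le d X w"
  unfolding width_le_def by simp

lemma width_leD:
  "width_le d X w \<Longrightarrow> A \<subseteq> X \<Longrightarrow>
    (\<And>x y. x \<in> A \<Longrightarrow> y \<in> A \<Longrightarrow> x \<noteq> y \<Longrightarrow> \<not> comparable d x y) \<Longrightarrow> card A \<le> w"
  unfolding width_le_def by simp

lemma width_le_subset:
  assumes "width_le d X w" "Y \<subseteq> X"
  shows "width_le d Y w"
proof (rule width_leI)
  fix A assume "A \<subseteq> Y" "\<And>x y. x \<in> A \<Longrightarrow> y \<in> A \<Longrightarrow> x \<noteq> y \<Longrightarrow> \<not> comparable d x y"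
  then show "card A \<le> w"
    using width_leD[OF assms(1) order_trans[OF _ assms(2)]] by simp
qed

lemma width_le_mono:
  assumes "width_le d X v" "v \<le> w"
  shows "width_le d X w"
proof (rule width_leI)
  fix A assume "A \<subseteq> X" "\<And>x y. x \<in> A \<Longrightarrow> y \<in> A \<Longrightarrow> x \<noteq> y \<Longrightarrow> \<not> comparable d x y"
  then show "card A \<le> w"
    using width_leD[OF assms(1)] assms(2) by (meson order_trans)
qed

lemma width_le_empty [simp]: "width_le d {} w"
  by (simp add: width_le_def)

lemma width_le_chain:
  assumes "\<And>p q. p \<in> X \<Longrightarrow> q \<in> X \<Longrightarrow> p \<noteq> q \<Longrightarrow> comparable d p q"
  shows "width_le d X 1"
  unfolding width_le_def
proof (intro allI impI)
  fix A assume A: "A \<subseteq> X" "\<forall>x\<in>A. \<forall>y\<in>A. x \<noteq> y \<longrightarrow> \<not> comparable d x y"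
  then have "\<forall>x\<in>A. \<forall>y\<in>A. x = y"
    using assms by blast
  then show "card A \<le> 1"
    by (metis card_le_Suc0_iff_eq One_nat_def card.infinite zero_le)
qed

lemma width_le_Un:
  assumes "width_le d X m" "width_le d Y n"
  shows "width_le d (X \<union> Y) (m + n)"
  unfolding width_le_def
proof (intro allI impI)
  fix A assume A: "A \<subseteq> X \<union> Y" "\<forall>x\<in>A. \<forall>y\<in>A. x \<noteq> y \<longrightarrow> \<not> comparable d x y"
  have "card (A \<inter> X) \<le> m" "card (A \<inter> Y) \<le> n"
    using assms A(2) unfolding width_le_def by simp_all
  moreover have "A = (A \<inter> X) \<union> (A \<inter> Y)"
    using A(1) by blast
  ultimately show "card A \<le> m + n"
    by (metis add_mono card_Un_le le_trans)
qed

text \<open>An antichain that meets \<open>X\<close> avoids \<open>Y - K\<close>, so it splits into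
  a part in \<open>X\<close> and a part in \<open>K\<close>; one that misses \<open>X\<close> lies
  in \<open>Y\<close>. The width bounds for newly played points go through this lemma, with
  \<open>K\<close> the old points to which the new ones may be incomparable.\<close>

lemma width_le_stack:
  assumes X: "width_le d X m" and K: "width_le d K k" and Y: "width_le d Y n"
    and comp: "\<And>x y. x \<in> X \<Longrightarrow> y \<in> Y - K \<Longrightarrow> comparable d x y"
    and le: "m + k \<le> n"
  shows "width_le d (X \<union> Y) n"
  unfolding width_le_def
proof (intro allI impI)
  fix A assume A: "A \<subseteq> X \<union> Y" "\<forall>x\<in>A. \<forall>y\<in>A. x \<noteq> y \<longrightarrow> \<not> comparable d x y"
  show "card A \<le> n"
  proof (cases "A \<inter> X = {}")
    case True
    then have "A \<subseteq> Y" using A(1) by blast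
    then show ?thesis using Y A(2) unfolding width_le_def by blast
  next
    case False
    then obtain x where x: "x \<in> A" "x \<in> X" by blast
    have "y \<in> X \<union> K" if y: "y \<in> A" for y
    proof (rule ccontr)
      assume "y \<notin> X \<union> K"
      then have "y \<in> Y - K" "x \<noteq> y" using y A(1) x by auto
      then show False using comp[OF x(2)] A(2) x(1) y by metis
    qed
    then have "A \<subseteq> X \<union> K" by blast
    then have "card A \<le> m + k"
      using width_le_Un[OF X K] A(2) unfolding width_le_def by blast
    then show ?thesis using le by simp
  qed
qed

lemma valid_Cons:
  assumes "valid d st" "legal d st p c"
  shows "valid d ((p, c) # st)"
proof -
  have "comparable d p (fst x)" "comparable d (fst x) p" if "x \<in> set st" "snd x = c" for x
    using that assms(2) comparable_commute[of d p] unfolding legal_def by blast+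
  then show ?thesis using assms(1) unfolding valid_def by simp
qed

text \<open>Sequential composition of strategies. The induction follows the strategy tree, which
  branches over infinitely many colors, so no uniform bound on the number of rounds is
  involved.\<close>

lemma force_bind:
  assumes "force d Q st" "valid d st"
    and "\<And>s. Q s \<Longrightarrow> valid d s \<Longrightarrow> force d R s"
  shows "force d R st"
  using assms(1,2)
proof induction
  case (stop st)
  then show ?case using assms(3) by blast
next
  case (move st p)
  show ?case
    using move.hyps(1) by (rule force.move) (use move valid_Cons in blast)
qed

lemma ex_legal: "\<exists>c. legal d st p c"
proof -
  obtain c where "c \<notin> snd ` set st"
    using ex_new_if_finite[of "snd ` set st"] infinite_UNIV_nat by auto
  then have "legal d st p c" by (auto simp: legal_def)
  then show ?thesis ..
qed

text \<open>A new color is always a legal reply, so some play leads on to \<open>Q\<close>, and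
  along it points are only added. This controls the width of intermediate positions as well.\<close>

lemma force_width:
  assumes "force d Q st" and "\<And>s. Q s \<Longrightarrow> width_le d (fst ` set s) w"
  shows "width_le d (fst ` set st) w"
  using assms(1)
proof induction
  case (stop st)
  then show ?case using assms(2) by blast
next
  case (move st p)
  obtain c where "legal d st p c" using ex_legal by blast
  then have "width_le d (fst ` set ((p, c) # st)) w" using move by blast
  then show ?case by (rule width_le_subset) auto
qed

definition reflect :: "(vec \<times> nat) list \<Rightarrow> (vec \<times> nat) list" where
  "reflect st = map (\<lambda>x. (- fst x, snd x)) st"

lemma comparable_uminus [simp]: "comparable d (- p) (- q) \<longleftrightarrow> comparable d p q"
  by (auto simp: comparable_def below_def)

lemma vec_uminus_uminus: "- (- p) = (p :: vec)"
  by (simp add: fun_eq_iff)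

lemma reflect_reflect [simp]: "reflect (reflect st) = st"
  by (simp add: reflect_def comp_def vec_uminus_uminus)

lemma valid_reflect: "valid d st \<Longrightarrow> valid d (reflect st)"
  unfolding valid_def reflect_def set_map ball_simps(9) fst_conv snd_conv comparable_uminus
  by (metis vec_uminus_uminus)

text \<open>Negation reverses all orders and keeps comparability, hence freshness and legality; this
  yields dual strategies for free.\<close>

lemma force_reflect: "force d Q st \<Longrightarrow> force d (\<lambda>s. Q (reflect s)) (reflect st)"
proof (induction rule: force.induct)
  case (stop st)
  then show ?case by (auto intro: force.stop)
next
  case (move st p)
  show ?case
  proof (rule force.move)
    show "fresh d (reflect st) (- p)"
      using move.hyps(1) by (auto simp: fresh_def reflect_def)
    fix c assume "legal d (reflect st) (- p) c"
    then have "legal d st p c" by (auto simp: legal_def reflect_def)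
    from move.IH[OF this] show "force d (\<lambda>s. Q (reflect s)) ((- p, c) # reflect st)"
      by (simp add: reflect_def)
  qed
qed

section \<open>Corners of a box\<close>

definition inbox :: "nat \<Rightarrow> vec \<Rightarrow> vec \<Rightarrow> vec \<Rightarrow> bool" where
  "inbox d l u p \<longleftrightarrow> (\<forall>j<d. l j < p j \<and> p j < u j)"

text \<open>In a clear box every point is fresh, and all points of the box stand in the same
  relation to any given old point.\<close>

definition clear :: "nat \<Rightarrow> vec \<Rightarrow> vec \<Rightarrow> (vec \<times> nat) list \<Rightarrow> bool" where
  "clear d l u st \<longleftrightarrow> (\<forall>x\<in>set st. \<forall>j<d. fst x j \<le> l j \<or> u j \<le> fst x j)"

definition subbox :: "nat \<Rightarrow> vec \<Rightarrow> vec \<Rightarrow> vec \<Rightarrow> vec \<Rightarrow> bool" where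
  "subbox d l' u' l u \<longleftrightarrow> (\<forall>j<d. l j \<le> l' j \<and> l' j < u' j \<and> u' j \<le> u j)"

definition at_corner :: "nat \<Rightarrow> nat \<Rightarrow> vec \<Rightarrow> vec \<Rightarrow> vec \<Rightarrow> bool" where
  "at_corner d a l u p \<longleftrightarrow> u a \<le> p a \<and> (\<forall>j<d. j \<noteq> a \<longrightarrow> p j \<le> l j)"

definition chain :: "nat \<Rightarrow> (vec \<times> nat) set \<Rightarrow> bool" where
  "chain d C \<longleftrightarrow> (\<forall>x\<in>C. \<forall>y\<in>C. fst x \<noteq> fst y \<longrightarrow> comparable d (fst x) (fst y))"

definition reached ::
  "nat \<Rightarrow> nat \<Rightarrow> vec \<Rightarrow> vec \<Rightarrow> (vec \<times> nat) list \<Rightarrow> bool" where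
  "reached d w l u new \<longleftrightarrow>
     (\<forall>x\<in>set new. inbox d l u (fst x)) \<and> width_le d (fst ` set new) w"

text \<open>
  The chain \<open>C\<close> lies above the box \<open>(l', u')\<close> in the order \<open>a\<close> and below it in all other orders.
  Points played later inside \<open>(l', u')\<close> are thus incomparable to \<open>C\<close>, so they cannot reuse
  its colors, while they are above everything else in \<open>X\<close>.
\<close>

definition corner ::
  "nat \<Rightarrow> nat \<Rightarrow> vec \<Rightarrow> vec \<Rightarrow> (vec \<times> nat) set \<Rightarrow> (vec \<times> nat) set \<Rightarrow> vec \<Rightarrow> vec \<Rightarrow> bool" where
  "corner d a l u X C l' u' \<longleftrightarrow>
     subbox d l' u' l u \<and> C \<subseteq> X \<and> chain d C \<and> (\<forall>x\<in>C. at_corner d a l' u' (fst x)) \<and>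
     (\<forall>x\<in>X - C. \<forall>j<d. fst x j \<le> l' j)"

text \<open>The alternative with \<open>N\<close> is an escape clause for a Bertha who wastes
  colors: it bounds how often the auxiliary chain in \<open>corner_step\<close> can grow.\<close>

definition corner_won ::
  "nat \<Rightarrow> nat \<Rightarrow> nat \<Rightarrow> nat \<Rightarrow> vec \<Rightarrow> vec \<Rightarrow> (vec \<times> nat) list \<Rightarrow> (vec \<times> nat) list \<Rightarrow> bool" where
  "corner_won d N a w l u st st' \<longleftrightarrow>
     (\<exists>new. st' = new @ st \<and> reached d w l u new \<and>
        (N \<le> card (snd ` set new) \<or>
         (\<exists>C l' u'. corner d a l u (set new) C l' u' \<and> w \<le> card (snd ` C))))"

lemma width_le_fst_chain: "chain d C \<Longrightarrow> width_le d (fst ` C) 1"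
  by (rule width_le_chain) (auto simp: chain_def)

lemma incomparable_inbox:
  assumes "inbox d l u p" "a < d" "b < d" "u a \<le> q a" "q b \<le> l b"
  shows "\<not> comparable d p q" "p \<noteq> q"
proof -
  have "p a < q a" "q b < p b"
    using assms unfolding inbox_def by (meson less_le_trans le_less_trans)+
  then show "\<not> comparable d p q" "p \<noteq> q"
    using assms(2,3) by (auto simp: comparable_def below_def dest: less_asym)
qed

lemma inbox_at_corner:
  assumes "inbox d l u p" "at_corner d a l u q" "a < d" "b < d" "b \<noteq> a"
  shows "\<not> comparable d p q" "p \<noteq> q"
  using incomparable_inbox[of d l u p a b q] assms by (simp_all add: at_corner_def)

lemma inbox_subbox:
  assumes "inbox d l' u' p" "subbox d l' u' l u"
  shows "inbox d l u p"
  unfolding inbox_def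
proof (intro allI impI)
  fix j assume "j < d"
  then have "l' j < p j" "p j < u' j" "l j \<le> l' j" "u' j \<le> u j"
    using assms by (simp_all add: inbox_def subbox_def)
  then show "l j < p j \<and> p j < u j" by linarith
qed

lemma subbox_trans:
  assumes "subbox d l2 u2 l1 u1" "subbox d l1 u1 l u"
  shows "subbox d l2 u2 l u"
  unfolding subbox_def
proof (intro allI impI)
  fix j assume "j < d"
  then have "l1 j \<le> l2 j" "l2 j < u2 j" "u2 j \<le> u1 j" "l j \<le> l1 j" "u1 j \<le> u j"
    using assms by (simp_all add: subbox_def)
  then show "l j \<le> l2 j \<and> l2 j < u2 j \<and> u2 j \<le> u j" by linarith
qed

lemma clear_subbox:
  assumes "clear d l u st" "subbox d l' u' l u"
  shows "clear d l' u' st"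
  unfolding clear_def
proof (intro ballI allI impI)
  fix x j assume "x \<in> set st" "j < d"
  then have "fst x j \<le> l j \<or> u j \<le> fst x j" "l j \<le> l' j" "u' j \<le> u j"
    using assms by (simp_all add: clear_def subbox_def)
  then show "fst x j \<le> l' j \<or> u' j \<le> fst x j" by linarith
qed

lemma clear_append: "clear d l u (st @ st') \<longleftrightarrow> clear d l u st \<and> clear d l u st'"
  by (auto simp: clear_def)

lemma corner_clear:
  assumes "corner d a l u (set new) C l' u'"
  shows "clear d l' u' new"
  using assms unfolding corner_def clear_def at_corner_def by blast

lemma at_corner_subbox:
  assumes "at_corner d a l u p" "subbox d l' u' l u" "a < d"
  shows "at_corner d a l' u' p"
  unfolding at_corner_def
proof (intro conjI allI impI)
  have "u' a \<le> u a" "u a \<le> p a" using assms by (simp_all add: at_corner_def subbox_def)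
  then show "u' a \<le> p a" by linarith
  fix j assume "j < d" "j \<noteq> a"
  then have "p j \<le> l j" "l j \<le> l' j" using assms by (simp_all add: at_corner_def subbox_def)
  then show "p j \<le> l' j" by linarith
qed

lemma ex_above:
  assumes "finite X" "\<And>p j. p \<in> X \<Longrightarrow> j < d \<Longrightarrow> p j < (u :: vec) j"
  shows "\<exists>z :: vec. \<forall>j<d. z j < u j \<and> (\<forall>p\<in>X. p j < z j)"
proof -
  have "\<exists>z. z < u j \<and> (\<forall>p\<in>X. p j < z)" if "j < d" for j
  proof -
    \<comment> \<open>The extra element \<open>u j - 1\<close> keeps the maximum defined when
      \<open>X\<close> is empty.\<close>
    have "Max (insert (u j - 1) ((\<lambda>p. p j) ` X)) < u j"
      using assms that by (subst Max_less_iff) auto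
    then obtain z where "Max (insert (u j - 1) ((\<lambda>p. p j) ` X)) < z" "z < u j"
      using dense by blast
    then show ?thesis
      using assms(1) by (auto simp: Max_less_iff)
  qed
  then show ?thesis by metis
qed

lemma chain_insert:
  assumes "chain d C" "\<And>x. x \<in> C \<Longrightarrow> comparable d p (fst x)"
  shows "chain d (insert (p, c) C)"
  unfolding chain_def
proof (intro ballI impI)
  fix x y assume xy: "x \<in> insert (p, c) C" "y \<in> insert (p, c) C" "fst x \<noteq> fst y"
  then consider "x \<in> C" "y \<in> C" | "x = (p, c)" "y \<in> C" | "x \<in> C" "y = (p, c)" by fastforce
  then show "comparable d (fst x) (fst y)"
  proof cases
    case 1
    then show ?thesis using assms(1) xy(3) by (simp add: chain_def)
  next
    case 2
    then show ?thesis using assms(2) by simp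
  next
    case 3
    then show ?thesis using assms(2) comparable_commute[of d p "fst x"] by simp
  qed
qed

lemma width_le_insert:
  assumes "width_le d X (Suc w)" "\<And>q. q \<in> X \<Longrightarrow> comparable d p q"
  shows "width_le d (insert p X) (Suc w)"
proof -
  have "width_le d {p} 1" by (rule width_le_chain) auto
  then have "width_le d ({p} \<union> X) (Suc w)"
    by (rule width_le_stack[where K = "{}" and k = 0]) (use assms in auto)
  then show ?thesis by simp
qed

text \<open>The box moves above \<open>z\<close> in every order except \<open>a\<close>, where it
  keeps the lower bound \<open>la a\<close>. Points outside \<open>C\<close> therefore need to be
  below the old box only in order \<open>a\<close>; in the other orders being below \<open>z\<close>
  is enough. The \<open>min\<close> matters when \<open>C\<close> is empty, since \<open>z a\<close>
  may then be smaller than \<open>ua a\<close>.\<close>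

lemma corner_insert:
  assumes C: "C \<subseteq> X" "chain d C" "\<And>x. x \<in> C \<Longrightarrow> at_corner d a la ua (fst x)"
    and rest: "\<And>x. x \<in> X - C \<Longrightarrow> fst x a \<le> la a"
    and sub: "subbox d la ua l u" and a: "a < d"
    and z: "\<And>j. j < d \<Longrightarrow> z j < u j" "\<And>j. j < d \<Longrightarrow> la j < z j"
      "\<And>j x. j < d \<Longrightarrow> x \<in> X \<Longrightarrow> fst x j < z j"
  shows "corner d a l u (insert (z, c) X) (insert (z, c) C)
    (\<lambda>j. if j = a then la j else z j) (\<lambda>j. if j = a then min (ua j) (z j) else u j)"
    (is "corner d a l u _ _ ?l ?u")
  unfolding corner_def
proof (intro conjI ballI allI impI)
  show "subbox d ?l ?u l u"
    unfolding subbox_def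
  proof (intro allI impI)
    fix j assume j: "j < d"
    have "l j \<le> la j" "la j < ua j" "ua j \<le> u j" using sub j by (auto simp: subbox_def)
    then show "l j \<le> ?l j \<and> ?l j < ?u j \<and> ?u j \<le> u j"
      using z(1,2)[OF j] by auto
  qed
  show "insert (z, c) C \<subseteq> insert (z, c) X" using C(1) by auto
  have "comparable d z (fst x)" if "x \<in> C" for x
    using z(3)[OF _ subsetD[OF C(1) that]] by (simp add: comparable_def below_def)
  with C(2) show "chain d (insert (z, c) C)" by (rule chain_insert)
next
  fix x assume x: "x \<in> insert (z, c) C"
  show "at_corner d a ?l ?u (fst x)"
  proof (cases "x = (z, c)")
    case True
    then show ?thesis by (simp add: at_corner_def)
  next
    case False
    then have "x \<in> C" using x by blast
    have "ua a \<le> fst x a" using C(3)[OF \<open>x \<in> C\<close>] by (simp add: at_corner_def)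
    moreover have "fst x j < z j" if "j < d" for j
      using z(3)[OF that subsetD[OF C(1) \<open>x \<in> C\<close>]] .
    ultimately show ?thesis by (simp add: at_corner_def min_le_iff_disj less_imp_le)
  qed
next
  fix x j assume x: "x \<in> insert (z, c) X - insert (z, c) C" and j: "j < d"
  then have "fst x a \<le> la a" "fst x j < z j" using rest[of x] z(3)[OF j, of x] by auto
  then show "fst x j \<le> ?l j" by simp
qed

text \<open>
  A chain \<open>Cb\<close> sits at corner \<open>b\<close>.  Anna builds a chain \<open>Ca\<close> with \<open>w\<close> colors at corner \<open>a\<close> of the
  remaining box and puts a point \<open>z\<close> above everything.  A color outside \<open>Ca\<close> extends \<open>Ca\<close>, and
  we are done.  A color from \<open>Ca\<close> is new for \<open>Cb\<close>, so \<open>Cb\<close> grows; this can happen at most \<open>N\<close> times.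
\<close>

lemma corner_step:
  assumes ab: "a < d" "b < d" "a \<noteq> b"
    and IH: "\<And>st l u. valid d st \<Longrightarrow> clear d l u st \<Longrightarrow> subbox d l u l u \<Longrightarrow>
               force d (corner_won d N a w l u st) st"
    and clr: "clear d l u st" and box: "subbox d l u l u"
    and val: "valid d (new @ st)" and reach: "reached d (Suc w) l u new"
    and cor: "corner d b l u (set new) Cb lb ub"
  shows "force d (corner_won d N a (Suc w) l u st) (new @ st)"
  using val reach cor
\<comment> \<open>The measure is the number of colors \<open>Cb\<close> still lacks to reach
  \<open>N\<close>; it drops whenever \<open>z\<close> is added to \<open>Cb\<close>.\<close>
proof (induction "N - card (snd ` Cb)" arbitrary: new Cb lb ub rule: less_induct)
  case less
  note val = less.prems(1) and reach = less.prems(2) and cor = less.prems(3)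
  show ?case
  proof (cases "N \<le> card (snd ` Cb)")
    case True
    have "card (snd ` Cb) \<le> card (snd ` set new)"
      using cor by (intro card_mono) (auto simp: corner_def)
    then show ?thesis
      using True reach by (intro force.stop) (auto simp: corner_won_def)
  next
    case False
    have sub: "subbox d lb ub l u" and Cb: "Cb \<subseteq> set new" "chain d Cb"
      and Cb_corner: "\<And>x. x \<in> Cb \<Longrightarrow> at_corner d b lb ub (fst x)"
      and Cb_rest: "\<And>x j. x \<in> set new - Cb \<Longrightarrow> j < d \<Longrightarrow> fst x j \<le> lb j"
      using cor by (auto simp: corner_def)
    \<comment> \<open>The strategy for width \<open>w\<close> is played inside the box left by
      \<open>Cb\<close>, hence with colors that do not occur on \<open>Cb\<close>.\<close>
    have "force d (corner_won d N a w lb ub (new @ st)) (new @ st)"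
    proof (rule IH[OF val])
      show "clear d lb ub (new @ st)"
        using corner_clear[OF cor] clear_subbox[OF clr sub] by (simp add: clear_append)
      show "subbox d lb ub lb ub" using sub by (auto simp: subbox_def)
    qed
    then show ?thesis
    proof (rule force_bind[OF _ val])
      fix s assume "corner_won d N a w lb ub (new @ st) s" and val1: "valid d s"
      then obtain new1 where s: "s = (new1 @ new) @ st" and reach1: "reached d w lb ub new1"
        and new1: "N \<le> card (snd ` set new1) \<or>
          (\<exists>C l' u'. corner d a lb ub (set new1) C l' u' \<and> w \<le> card (snd ` C))"
        unfolding corner_won_def by auto
      have inb1: "\<And>x. x \<in> set new1 \<Longrightarrow> inbox d lb ub (fst x)"
        and w1: "width_le d (fst ` set new1) w"
        using reach1 by (auto simp: reached_def)
      have inb: "inbox d l u (fst x)" if "x \<in> set (new1 @ new)" for x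
        using that inb1[of x] inbox_subbox[OF _ sub, of "fst x"] reach by (auto simp: reached_def)
      have wid: "width_le d (fst ` set (new1 @ new)) (Suc w)"
      proof -
        have "width_le d (fst ` set new1 \<union> fst ` set new) (Suc w)"
        \<comment> \<open>The points of \<open>new1\<close> are above all of \<open>new\<close>
          except the chain \<open>Cb\<close>, which contributes at most one point to an
          antichain.\<close>
        proof (rule width_le_stack[OF w1 width_le_fst_chain[OF Cb(2)]])
          show "width_le d (fst ` set new) (Suc w)" using reach by (simp add: reached_def)
          fix x y assume "x \<in> fst ` set new1" "y \<in> fst ` set new - fst ` Cb"
          then have "inbox d lb ub x" "\<forall>j<d. y j \<le> lb j"
            using inb1 Cb_rest by blast+
          then show "comparable d x y"
            unfolding comparable_def below_def inbox_def by (meson le_less_trans)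
        qed simp
        then show ?thesis by (simp add: image_Un)
      qed
      have reach': "reached d (Suc w) l u (new1 @ new)"
        using inb wid by (simp add: reached_def)
      show "force d (corner_won d N a (Suc w) l u st) s"
      proof (cases "N \<le> card (snd ` set new1)")
        case True
        have "card (snd ` set new1) \<le> card (snd ` set (new1 @ new))"
          by (intro card_mono) auto
        then show ?thesis
          using True reach' s by (intro force.stop) (auto simp: corner_won_def simp del: set_append)
      next
        case False
        with new1 obtain Ca la ua where cora: "corner d a lb ub (set new1) Ca la ua"
          and wCa: "w \<le> card (snd ` Ca)" by blast
        have suba: "subbox d la ua lb ub" and Ca: "Ca \<subseteq> set new1" "chain d Ca"
          and Ca_corner: "\<And>x. x \<in> Ca \<Longrightarrow> at_corner d a la ua (fst x)"
          and Ca_rest: "\<And>x j. x \<in> set new1 - Ca \<Longrightarrow> j < d \<Longrightarrow> fst x j \<le> la j"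
          using cora by (auto simp: corner_def)
        \<comment> \<open>Including \<open>l\<close> keeps \<open>z\<close> inside the outer box
          even if nothing was played there; including \<open>la\<close> makes room for the box that
          \<open>corner_insert\<close> builds.\<close>
        have "\<exists>z :: vec. \<forall>j<d. z j < u j \<and> (\<forall>p\<in>insert la (insert l (fst ` set (new1 @ new))). p j < z j)"
        proof (rule ex_above)
          fix p j assume "p \<in> insert la (insert l (fst ` set (new1 @ new)))" "j < d"
          then consider "p = la" | "p = l" | x where "x \<in> set (new1 @ new)" "p = fst x" by blast
          then show "p j < u j"
          proof cases
            case 1
            have "la j < ua j" "ua j \<le> ub j" "ub j \<le> u j"
              using sub suba \<open>j < d\<close> by (auto simp: subbox_def)
            then show ?thesis using 1 by simp
          next
            case 2
            then show ?thesis using box \<open>j < d\<close> by (auto simp: subbox_def)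
          next
            case 3
            then show ?thesis using inb \<open>j < d\<close> by (auto simp: inbox_def)
          qed
        qed simp
        then obtain z :: vec where z: "\<And>j. j < d \<Longrightarrow> z j < u j" "\<And>j. j < d \<Longrightarrow> la j < z j"
          "\<And>j. j < d \<Longrightarrow> l j < z j"
          "\<And>j x. j < d \<Longrightarrow> x \<in> set (new1 @ new) \<Longrightarrow> fst x j < z j"
          by auto
        have zcomp: "comparable d z (fst x)" if "x \<in> set (new1 @ new)" for x
          using z(4) that by (auto simp: comparable_def below_def)
        show ?thesis
        proof (rule force.move)
          show "fresh d s z"
            unfolding fresh_def
          proof (intro ballI allI impI)
            fix x j assume "x \<in> set s" "j < d"
            then consider "x \<in> set (new1 @ new)" | "x \<in> set st" by (auto simp: s)
            then show "z j \<noteq> fst x j"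
            proof cases
              case 1 then show ?thesis using z(4)[OF \<open>j < d\<close> 1] by simp
            next
              case 2 then show ?thesis
                using clr z(1,3)[OF \<open>j < d\<close>] \<open>j < d\<close> unfolding clear_def by force
            qed
          qed
          fix c assume leg: "legal d s z c"
          define new' where "new' = (z, c) # new1 @ new"
          have s': "(z, c) # s = new' @ st" by (simp add: s new'_def)
          have val': "valid d (new' @ st)" using valid_Cons[OF val1 leg] by (simp add: s')
          have "width_le d (insert z (fst ` set (new1 @ new))) (Suc w)"
          proof (rule width_le_insert[OF wid])
            fix q assume "q \<in> fst ` set (new1 @ new)"
            then show "comparable d z q" using zcomp by blast
          qed
          then have reach2: "reached d (Suc w) l u new'"
            using inb z(1,3) by (simp add: new'_def reached_def inbox_def)
          have le_la: "lb j \<le> la j" if "j < d" for j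
            using suba that by (auto simp: subbox_def)
          have sub': "subbox d la ua l u" using suba sub by (rule subbox_trans)
          have X: "set new' = insert (z, c) (set (new1 @ new))" by (simp add: new'_def)
          show "force d (corner_won d N a (Suc w) l u st) ((z, c) # s)"
          proof (cases "c \<in> snd ` Ca")
            case False
            \<comment> \<open>\<open>Ca\<close> grows and wins. The points of \<open>new\<close>,
              including those of \<open>Cb\<close>, are at most \<open>lb a\<close> in order
              \<open>a\<close>, because \<open>Cb\<close> exceeds its box only in order
              \<open>b\<close>.\<close>
            have "\<exists>l' u'. corner d a l u (set new') (insert (z, c) Ca) l' u'"
              unfolding X
            proof (intro exI, rule corner_insert[OF _ Ca(2) Ca_corner _ sub' ab(1) z(1,2,4)])
              show "Ca \<subseteq> set (new1 @ new)" using Ca(1) by auto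
              fix x assume x: "x \<in> set (new1 @ new) - Ca"
              show "fst x a \<le> la a"
              proof (cases "x \<in> set new1")
                case True
                then show ?thesis using Ca_rest x ab(1) by blast
              next
                case False
                have "fst x a \<le> lb a"
                proof (cases "x \<in> Cb")
                  case True
                  then show ?thesis using Cb_corner[OF True] ab by (simp add: at_corner_def)
                next
                  case c: False
                  then show ?thesis using Cb_rest[of x a] x False ab(1) by simp
                qed
                then show ?thesis using le_la[OF ab(1)] by simp
              qed
            qed
            moreover have "Suc w \<le> card (snd ` insert (z, c) Ca)"
              using False wCa finite_subset[OF Ca(1)] by simp
            ultimately show ?thesis
              unfolding s' using reach2 by (intro force.stop) (unfold corner_won_def, blast)
          next
            case True
            then obtain x where x: "x \<in> Ca" "snd x = c" by auto
            \<comment> \<open>A point of \<open>Ca\<close> lies in the box at whose corner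
              \<open>Cb\<close> sits, so it is incomparable to \<open>Cb\<close> and validity
              excludes a common color.\<close>
            have cb: "c \<notin> snd ` Cb"
            proof
              assume "c \<in> snd ` Cb"
              then obtain y where y: "y \<in> Cb" "snd y = c" by auto
              have "x \<in> set s" "y \<in> set s" using x y Ca(1) Cb(1) by (auto simp: s)
              then have "fst x = fst y \<or> comparable d (fst x) (fst y)"
                using val1 x y unfolding valid_def by simp
              moreover have "inbox d lb ub (fst x)" using inb1[OF subsetD[OF Ca(1) x(1)]] .
              ultimately show False
                using inbox_at_corner[OF _ Cb_corner[OF y(1)] ab(2) ab(1) ab(3)] by blast
            qed
            \<comment> \<open>\<open>Cb\<close> grows and \<open>Ca\<close> is given up.
              \<open>Ca\<close> exceeds the box \<open>(la, ua)\<close> only in order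
              \<open>a\<close>, so in order \<open>b\<close> it counts among the points
              below.\<close>
            have "\<exists>l' u'. corner d b l u (set new') (insert (z, c) Cb) l' u'"
              unfolding X
            proof (intro exI, rule corner_insert[OF _ Cb(2) _ _ sub' ab(2) z(1,2,4)])
              show "Cb \<subseteq> set (new1 @ new)" using Cb(1) by auto
              show "at_corner d b la ua (fst x)" if "x \<in> Cb" for x
                using at_corner_subbox[OF Cb_corner[OF that] suba ab(2)] .
              fix x assume x: "x \<in> set (new1 @ new) - Cb"
              show "fst x b \<le> la b"
              proof (cases "x \<in> set new1")
                case True
                show ?thesis
                proof (cases "x \<in> Ca")
                  case True
                  then show ?thesis using Ca_corner[OF True] ab by (simp add: at_corner_def)
                next
                  case False
                  then show ?thesis using Ca_rest[of x b] True ab(2) by simp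
                qed
              next
                case False
                then show ?thesis using Cb_rest[of x b] x ab(2) le_la[OF ab(2)] by simp
              qed
            qed
            then obtain l' u' where cor': "corner d b l u (set new') (insert (z, c) Cb) l' u'"
              by blast
            have "card (snd ` insert (z, c) Cb) = Suc (card (snd ` Cb))"
              using cb finite_subset[OF Cb(1)] by simp
            then have "N - card (snd ` insert (z, c) Cb) < N - card (snd ` Cb)"
              using \<open>\<not> N \<le> card (snd ` Cb)\<close> by simp
            then show ?thesis
              unfolding s' by (rule less.hyps[OF _ val' reach2 cor'])
          qed
        qed
      qed
    qed
  qed
qed

text \<open>Induction on \<open>w\<close>: the empty chain does for \<open>w = 0\<close>, and
  \<open>corner_step\<close> starts with an empty auxiliary chain at a second order
  \<open>b\<close>, which exists because \<open>d \<ge> 2\<close>.\<close>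

lemma corner_force:
  assumes "a < d" "d \<ge> 2" "valid d st" "clear d l u st" "subbox d l u l u"
  shows "force d (corner_won d N a w l u st) st"
  using assms(3-5)
proof (induction w arbitrary: st l u)
  case 0
  then show ?case
    by (intro force.stop)
      (auto simp: corner_won_def reached_def corner_def chain_def intro!: exI[of _ "[]"])
next
  case (Suc w)
  obtain b where b: "b < d" "a \<noteq> b"
    using assms(1,2) by (metis One_nat_def Suc_1 Suc_le_lessD less_2_cases_iff less_le_trans zero_neq_one)
  have "force d (corner_won d N a (Suc w) l u st) ([] @ st)"
  proof (rule corner_step[OF assms(1) b Suc.IH])
    show "reached d (Suc w) l u []" by (simp add: reached_def)
    show "corner d b l u (set []) {} l u" using Suc.prems by (simp add: corner_def chain_def)
  qed (use Suc.prems in auto)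
  then show ?case by simp
qed

section \<open>Nested corners for several orders\<close>

definition corners ::
  "nat \<Rightarrow> nat \<Rightarrow> nat \<Rightarrow> vec \<Rightarrow> vec \<Rightarrow> (vec \<times> nat) set \<Rightarrow> (nat \<Rightarrow> (vec \<times> nat) set) \<Rightarrow>
     vec \<Rightarrow> vec \<Rightarrow> bool" where
  "corners d k v l u X C l' u' \<longleftrightarrow>
     subbox d l' u' l u \<and>
     (\<forall>i<k. C i \<subseteq> X \<and> chain d (C i) \<and> (\<forall>x\<in>C i. at_corner d i l' u' (fst x)) \<and>
        v \<le> card (snd ` C i)) \<and>
     (\<forall>x\<in>X. (\<forall>i<k. x \<notin> C i) \<longrightarrow> (\<forall>j<d. fst x j \<le> l' j))"

text \<open>The allowance \<open>v + k\<close> reflects that an antichain using points of the next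
  box can pick up at most one point of each earlier chain.\<close>

definition corners_won ::
  "nat \<Rightarrow> nat \<Rightarrow> nat \<Rightarrow> nat \<Rightarrow> vec \<Rightarrow> vec \<Rightarrow> (vec \<times> nat) list \<Rightarrow> (vec \<times> nat) list \<Rightarrow> bool" where
  "corners_won d N k v l u st st' \<longleftrightarrow>
     (\<exists>new. st' = new @ st \<and> reached d (v + k) l u new \<and>
        (N \<le> card (snd ` set new) \<or> (\<exists>C l' u'. corners d k v l u (set new) C l' u')))"

lemma width_le_UN:
  fixes K :: "nat \<Rightarrow> vec set"
  assumes "\<And>i. i < k \<Longrightarrow> width_le d (K i) 1"
  shows "width_le d (\<Union>i<k. K i) k"
  using assms
proof (induction k)
  case (Suc k)
  have "width_le d (\<Union>i<k. K i) k" "width_le d (K k) 1"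
    using Suc by simp_all
  from width_le_Un[OF this] show ?case by (simp add: lessThan_Suc Un_commute)
qed simp

text \<open>Bookkeeping for moving play into a subbox: \<open>K\<close> collects the old points that
  may be incomparable to the subbox, so an antichain with a new point takes its old points from
  \<open>K\<close>.\<close>

lemma reached_append:
  assumes new: "reached d n l u new" and sub: "subbox d l' u' l u"
    and new1: "reached d m l' u' new1"
    and K: "width_le d (fst ` K) k" "K \<subseteq> set new"
    and comp: "\<And>x p. x \<in> set new - K \<Longrightarrow> inbox d l' u' p \<Longrightarrow> comparable d p (fst x)"
    and le: "m + k \<le> n"
  shows "reached d n l u (new1 @ new)"
proof -
  have "width_le d (fst ` set new1 \<union> fst ` set new) n"
  proof (rule width_le_stack[OF _ K(1) _ _ le])
    show "width_le d (fst ` set new1) m" "width_le d (fst ` set new) n"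
      using new new1 by (simp_all add: reached_def)
    fix x y assume x: "x \<in> fst ` set new1" and y: "y \<in> fst ` set new - fst ` K"
    from x obtain x' where "x' \<in> set new1" "x = fst x'" by blast
    then have inb: "inbox d l' u' x" using new1 by (simp add: reached_def)
    from y obtain y' where y': "y = fst y'" "y' \<in> set new" by blast
    with y have "y' \<notin> K" by blast
    with y' show "comparable d x y" using comp[of y', OF _ inb] by simp
  qed
  moreover have "inbox d l u (fst x)" if "x \<in> set (new1 @ new)" for x
    using that new new1 inbox_subbox[OF _ sub, of "fst x"]
    unfolding reached_def set_append by blast
  ultimately show ?thesis by (simp add: reached_def image_Un)
qed

lemma comparable_inbox_below:
  assumes "inbox d l u p" "\<And>j. j < d \<Longrightarrow> q j \<le> l j"
  shows "comparable d p q"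
proof -
  have "q j < p j" if "j < d" for j
    using assms(2)[OF that] assms(1) that by (auto simp: inbox_def intro: le_less_trans)
  then show ?thesis by (simp add: comparable_def below_def)
qed

lemma comparable_inbox_above:
  assumes "inbox d l u p" "\<And>j. j < d \<Longrightarrow> u j \<le> q j"
  shows "comparable d p q"
proof -
  have "p j < q j" if "j < d" for j
    using assms(2)[OF that] assms(1) that by (auto simp: inbox_def intro: less_le_trans)
  then show ?thesis by (simp add: comparable_def below_def)
qed

lemma corners_clear:
  assumes "corners d k v l u (set new) C l' u'" "k \<le> d"
  shows "clear d l' u' new"
  unfolding clear_def
proof (intro ballI allI impI)
  fix x j assume x: "x \<in> set new" and j: "j < d"
  show "fst x j \<le> l' j \<or> u' j \<le> fst x j"
  proof (cases "\<exists>i<k. x \<in> C i")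
    case True
    then obtain i where i: "i < k" "x \<in> C i" by blast
    then have "at_corner d i l' u' (fst x)" using assms(1) by (simp add: corners_def)
    then show ?thesis using j by (cases "j = i") (simp_all add: at_corner_def)
  next
    case False
    then show ?thesis using assms(1) x j by (simp add: corners_def)
  qed
qed

text \<open>Corner \<open>k\<close> is played inside the box left by the first \<open>k\<close>
  corners. Shrinking the box keeps the earlier chains at their corners, and a new point is either on
  the new chain or below the final box.\<close>

lemma corners_force:
  assumes "k \<le> d" "d \<ge> 2" "valid d st" "clear d l u st" "subbox d l u l u"
  shows "force d (corners_won d N k v l u st) st"
  using assms(1)
proof (induction k)
  case 0
  have "corners_won d N 0 v l u st st"
    unfolding corners_won_def
  proof (intro exI conjI disjI2)
    show "st = [] @ st" by simp
    show "reached d (v + 0) l u []" by (simp add: reached_def)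
    show "corners d 0 v l u (set []) (\<lambda>_. {}) l u" using assms(5) by (simp add: corners_def)
  qed
  then show ?case by (rule force.stop)
next
  case (Suc k)
  then have k: "k < d" by simp
  have "force d (corners_won d N k v l u st) st" using Suc by simp
  then show ?case
  proof (rule force_bind[OF _ assms(3)])
    fix s assume "corners_won d N k v l u st s" and val: "valid d s"
    then obtain new where s: "s = new @ st" and reach: "reached d (v + k) l u new"
      and won: "N \<le> card (snd ` set new) \<or> (\<exists>C l' u'. corners d k v l u (set new) C l' u')"
      unfolding corners_won_def by blast
    have reach': "reached d (v + Suc k) l u new"
      using reach unfolding reached_def by (auto elim: width_le_mono)
    show "force d (corners_won d N (Suc k) v l u st) s"
    proof (cases "N \<le> card (snd ` set new)")
      case True
      then show ?thesis using s reach' by (intro force.stop) (unfold corners_won_def, blast)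
    next
      case False
      then obtain C l' u' where cor: "corners d k v l u (set new) C l' u'" using won by blast
      have sub: "subbox d l' u' l u" using cor by (simp add: corners_def)
      have "force d (corner_won d N k v l' u' s) s"
      proof (rule corner_force[OF k assms(2) val])
        show "clear d l' u' s"
          using corners_clear[OF cor] k clear_subbox[OF assms(4) sub] s by (simp add: clear_append)
        show "subbox d l' u' l' u'" using sub by (simp add: subbox_def)
      qed
      then show ?thesis
      proof (rule force_bind[OF _ val], intro force.stop)
        fix s' assume "corner_won d N k v l' u' s s'"
        then obtain new1 where s': "s' = (new1 @ new) @ st" and reach1: "reached d v l' u' new1"
          and won1: "N \<le> card (snd ` set new1) \<or>
            (\<exists>C l2 u2. corner d k l' u' (set new1) C l2 u2 \<and> v \<le> card (snd ` C))"
          unfolding corner_won_def s append_assoc by blast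
        have reach2: "reached d (v + Suc k) l u (new1 @ new)"
        proof (rule reached_append[OF reach' sub reach1])
          have "width_le d (\<Union>i<k. fst ` C i) k"
            using cor by (intro width_le_UN width_le_fst_chain) (simp add: corners_def)
          then show "width_le d (fst ` (\<Union>i<k. C i)) k" by (simp add: image_UN)
          show "(\<Union>i<k. C i) \<subseteq> set new" using cor unfolding corners_def by blast
          fix x p assume x: "x \<in> set new - (\<Union>i<k. C i)" and p: "inbox d l' u' p"
          have "fst x j \<le> l' j" if "j < d" for j
            using cor x that by (simp add: corners_def)
          with p show "comparable d p (fst x)" by (rule comparable_inbox_below)
        qed simp
        have "N \<le> card (snd ` set (new1 @ new)) \<or>
          (\<exists>C l2 u2. corners d (Suc k) v l u (set (new1 @ new)) C l2 u2)"
        proof (cases "N \<le> card (snd ` set new1)")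
          case True
          have "card (snd ` set new1) \<le> card (snd ` set (new1 @ new))" by (intro card_mono) auto
          then show ?thesis using True by simp
        next
          case False
          then obtain C1 l2 u2 where cor1: "corner d k l' u' (set new1) C1 l2 u2"
            and v: "v \<le> card (snd ` C1)" using won1 by blast
          have sub1: "subbox d l2 u2 l' u'" using cor1 by (simp add: corner_def)
          have "corners d (Suc k) v l u (set (new1 @ new)) (C(k := C1)) l2 u2"
            unfolding corners_def
          proof (intro conjI allI impI ballI)
            show "subbox d l2 u2 l u" using sub1 sub by (rule subbox_trans)
            fix i assume i: "i < Suc k"
            show "(C(k := C1)) i \<subseteq> set (new1 @ new)"
            proof (cases "i = k")
              case True
              then show ?thesis using cor1 by (simp add: corner_def le_supI1)
            next
              case False
              then have "C i \<subseteq> set new" using i cor by (simp add: corners_def)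
              then show ?thesis using False by (simp add: le_supI2)
            qed
            show "chain d ((C(k := C1)) i)"
              using i cor cor1 by (cases "i = k") (simp_all add: corner_def corners_def)
            show "v \<le> card (snd ` (C(k := C1)) i)"
              using i v cor by (cases "i = k") (simp_all add: corners_def)
            fix x assume x: "x \<in> (C(k := C1)) i"
            show "at_corner d i l2 u2 (fst x)"
            proof (cases "i = k")
              case True
              then show ?thesis using x cor1 by (simp add: corner_def)
            next
              case False
              then have "at_corner d i l' u' (fst x)" using x i cor by (simp add: corners_def)
              then show ?thesis using sub1 i k by (auto intro: at_corner_subbox)
            qed
          next
            fix x j assume x: "x \<in> set (new1 @ new)" and nC: "\<forall>i<Suc k. x \<notin> (C(k := C1)) i"
              and j: "j < d"
            have "x \<notin> C1" using nC[rule_format, of k] by simp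
            have xC: "x \<notin> C i" if "i < k" for i using nC[rule_format, of i] that by simp
            show "fst x j \<le> l2 j"
            proof (cases "x \<in> set new1")
              case True
              then show ?thesis using cor1 \<open>x \<notin> C1\<close> j by (simp add: corner_def)
            next
              case False
              then have "fst x j \<le> l' j" using cor x xC j by (simp add: corners_def)
              also have "\<dots> \<le> l2 j" using sub1 j by (simp add: subbox_def)
              finally show ?thesis .
            qed
          qed
          then show ?thesis by blast
        qed
        then show "corners_won d N (Suc k) v l u st s'"
          using s' reach2 unfolding corners_won_def by blast
      qed
    qed
  qed
qed

section \<open>The order dual\<close>

text \<open>This is \<open>corner\<close> after negating all coordinates, which also exchanges the
  two bounds of each box.\<close>

definition top_corner ::
  "nat \<Rightarrow> nat \<Rightarrow> vec \<Rightarrow> vec \<Rightarrow> (vec \<times> nat) set \<Rightarrow> (vec \<times> nat) set \<Rightarrow> vec \<Rightarrow> vec \<Rightarrow> bool" where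
  "top_corner d a l u X C l' u' \<longleftrightarrow>
     subbox d l' u' l u \<and> C \<subseteq> X \<and> chain d C \<and> (\<forall>x\<in>C. fst x a \<le> l' a) \<and>
     (\<forall>x\<in>C. \<forall>j<d. j \<noteq> a \<longrightarrow> u' j \<le> fst x j) \<and> (\<forall>x\<in>X - C. \<forall>j<d. u' j \<le> fst x j)"

definition top_won ::
  "nat \<Rightarrow> nat \<Rightarrow> nat \<Rightarrow> nat \<Rightarrow> vec \<Rightarrow> vec \<Rightarrow> (vec \<times> nat) list \<Rightarrow> (vec \<times> nat) list \<Rightarrow> bool" where
  "top_won d N a w l u st st' \<longleftrightarrow>
     (\<exists>new. st' = new @ st \<and> reached d w l u new \<and>
        (N \<le> card (snd ` set new) \<or>
         (\<exists>C l' u'. top_corner d a l u (set new) C l' u' \<and> w \<le> card (snd ` C))))"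

abbreviation reflect_point :: "vec \<times> nat \<Rightarrow> vec \<times> nat" where
  "reflect_point x \<equiv> (- fst x, snd x)"

lemma width_le_uminus:
  assumes "width_le d X w"
  shows "width_le d (uminus ` X) w"
proof (rule width_leI)
  fix A assume A: "A \<subseteq> uminus ` X"
    "\<And>x y. x \<in> A \<Longrightarrow> y \<in> A \<Longrightarrow> x \<noteq> y \<Longrightarrow> \<not> comparable d x y"
  have inj: "inj_on uminus (B :: vec set)" for B
    by (rule inj_onI) (metis vec_uminus_uminus)
  have "card (uminus ` A) \<le> w"
  proof (rule width_leD[OF assms])
    have "uminus ` A \<subseteq> uminus ` uminus ` X" using A(1) by (rule image_mono)
    then show "uminus ` A \<subseteq> X" by (simp add: image_image vec_uminus_uminus)
    fix x y assume "x \<in> uminus ` A" "y \<in> uminus ` A" and ne: "x \<noteq> y"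
    then obtain x' y' where "x' \<in> A" "y' \<in> A" "x = - x'" "y = - y'" by (elim imageE)
    then show "\<not> comparable d x y" using A(2)[of x' y'] ne by auto
  qed
  then show "card A \<le> w" by (simp add: card_image[OF inj])
qed

text \<open>\<open>corner_force\<close> is run in the negated box \<open>(- u, - l)\<close> on the
  reflected position, and the outcome is reflected back.\<close>

lemma top_force:
  assumes "a < d" "d \<ge> 2" "valid d st" "clear d l u st" "subbox d l u l u"
  shows "force d (top_won d N a w l u st) st"
proof -
  have "force d (corner_won d N a w (- u) (- l) (reflect st)) (reflect st)"
  proof (rule corner_force[OF assms(1,2) valid_reflect[OF assms(3)]])
    show "clear d (- u) (- l) (reflect st)"
      using assms(4) unfolding clear_def reflect_def by force
    show "subbox d (- u) (- l) (- u) (- l)"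
      using assms(5) by (simp add: subbox_def)
  qed
  from force_reflect[OF this]
  have "force d (\<lambda>s. corner_won d N a w (- u) (- l) (reflect st) (reflect s)) st" by simp
  then show ?thesis
  proof (rule force_bind[OF _ assms(3)], intro force.stop)
    fix s assume "corner_won d N a w (- u) (- l) (reflect st) (reflect s)"
    then obtain new where s: "reflect s = new @ reflect st"
      and reach: "reached d w (- u) (- l) new"
      and won: "N \<le> card (snd ` set new) \<or>
         (\<exists>C l' u'. corner d a (- u) (- l) (set new) C l' u' \<and> w \<le> card (snd ` C))"
      unfolding corner_won_def by blast
    have "s = reflect (new @ reflect st)" using s reflect_reflect[of s] by simp
    also have "\<dots> = reflect new @ reflect (reflect st)" by (simp add: reflect_def)
    finally have s': "s = reflect new @ st" by simp
    have set_new: "set (reflect new) = reflect_point ` set new" by (simp add: reflect_def)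
    have snd_im: "snd ` reflect_point ` A = snd ` A" for A by (simp add: image_image)
    have "width_le d (uminus ` fst ` set new) w"
      using reach by (intro width_le_uminus) (simp add: reached_def)
    moreover have "inbox d l u (- fst x)" if "x \<in> set new" for x
    proof -
      have "inbox d (- u) (- l) (fst x)" using reach that by (simp add: reached_def)
      then show ?thesis unfolding inbox_def by (auto simp: minus_less_iff less_minus_iff)
    qed
    ultimately have reach': "reached d w l u (reflect new)"
      unfolding reached_def set_new by (simp add: image_image)
    have "N \<le> card (snd ` set (reflect new)) \<or>
      (\<exists>C l' u'. top_corner d a l u (set (reflect new)) C l' u' \<and> w \<le> card (snd ` C))"
      using won
    proof (elim disjE exE conjE)
      assume "N \<le> card (snd ` set new)"
      then show ?thesis unfolding set_new snd_im ..
    next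
      fix C l' u' assume cor: "corner d a (- u) (- l) (set new) C l' u'" and w: "w \<le> card (snd ` C)"
      have "top_corner d a l u (reflect_point ` set new) (reflect_point ` C) (- u') (- l')"
        unfolding top_corner_def
      proof (intro conjI)
        show "subbox d (- u') (- l') l u"
          using cor unfolding corner_def subbox_def by (auto simp: minus_le_iff le_minus_iff)
        show "reflect_point ` C \<subseteq> reflect_point ` set new"
          using cor unfolding corner_def by (intro image_mono) simp
        show "chain d (reflect_point ` C)"
        proof -
          have "chain d C" using cor by (simp add: corner_def)
          then have "comparable d (fst x) (fst y)" if "x \<in> C" "y \<in> C" "- fst x \<noteq> - fst y" for x y
            using that unfolding chain_def by metis
          then show ?thesis unfolding chain_def by simp
        qed
        show "\<forall>x\<in>reflect_point ` C. fst x a \<le> (- u') a"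
          using cor by (simp add: corner_def at_corner_def)
        show "\<forall>x\<in>reflect_point ` C. \<forall>j<d. j \<noteq> a \<longrightarrow> (- l') j \<le> fst x j"
          using cor by (simp add: corner_def at_corner_def)
        show "\<forall>x\<in>reflect_point ` set new - reflect_point ` C. \<forall>j<d. (- l') j \<le> fst x j"
        proof (intro ballI allI impI)
          fix x j assume x: "x \<in> reflect_point ` set new - reflect_point ` C" and j: "j < d"
          then obtain y where y: "y \<in> set new" "x = reflect_point y" by blast
          with x have "y \<notin> C" by blast
          with y cor j have "fst y j \<le> l' j" by (simp add: corner_def)
          then show "(- l') j \<le> fst x j" using y(2) by simp
        qed
      qed
      moreover have "w \<le> card (snd ` reflect_point ` C)" using w by (simp only: snd_im)
      ultimately show ?thesis unfolding set_new by (intro disjI2 exI conjI)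
    qed
    then show "top_won d N a w l u st s"
      unfolding top_won_def using s' reach' by blast
  qed
qed

section \<open>Recursion into the middle\<close>

text \<open>The sets \<open>F i \<inter> Y\<close> are disjoint subsets of \<open>Y\<close>, so
  their sizes cannot all exceed the average \<open>card Y / k\<close>.\<close>

lemma ex_small_inter:
  fixes F :: "nat \<Rightarrow> nat set"
  assumes "finite Y" "0 < k"
    and disj: "\<And>i j. i < k \<Longrightarrow> j < k \<Longrightarrow> i \<noteq> j \<Longrightarrow> F i \<inter> F j = {}"
  shows "\<exists>i<k. k * card (F i \<inter> Y) \<le> card Y"
proof (rule ccontr)
  assume "\<not> ?thesis"
  then have less: "card Y < k * card (F i \<inter> Y)" if "i < k" for i
    using that by (simp add: not_le)
  have "k * card Y = (\<Sum>i<k. card Y)" by simp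
  also have "\<dots> < (\<Sum>i<k. k * card (F i \<inter> Y))"
    using less assms(2) by (intro sum_strict_mono) auto
  also have "\<dots> = k * card (\<Union>i<k. F i \<inter> Y)"
  proof -
    have "card (\<Union>i\<in>{..<k}. F i \<inter> Y) = (\<Sum>i<k. card (F i \<inter> Y))"
      using assms(1) disj by (intro card_UN_disjoint) blast+
    then show ?thesis by (simp add: sum_distrib_left)
  qed
  also have "\<dots> \<le> k * card Y"
    using assms(1) by (intro mult_le_mono2 card_mono) auto
  finally show False by simp
qed

text \<open>A point of \<open>C i\<close> is above the common box in order \<open>i\<close> and
  below it in order \<open>j\<close>; for \<open>C j\<close> it is the other way round. Such points
  are incomparable, so they never share a color.\<close>

lemma corners_disjoint_colors:
  assumes cor: "corners d k v l u (set new) C l' u'" and k: "k \<le> d" and val: "valid d (st' @ new @ st)"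
    and ij: "i < k" "j < k" "i \<noteq> j"
  shows "snd ` C i \<inter> snd ` C j = {}"
proof (rule ccontr)
  assume "snd ` C i \<inter> snd ` C j \<noteq> {}"
  then obtain x y where xy: "x \<in> C i" "y \<in> C j" "snd x = snd y" by (auto simp: image_iff)
  have "u' i \<le> fst x i" "u' j \<le> fst y j" "fst x j \<le> l' j" "fst y i \<le> l' i"
    using cor xy ij k by (simp_all add: corners_def at_corner_def)
  moreover have "l' i < u' i" "l' j < u' j" using cor ij k by (simp_all add: corners_def subbox_def)
  ultimately have *: "fst y i < fst x i" "fst x j < fst y j" by linarith+
  have "x \<in> set new" "y \<in> set new" using cor xy ij unfolding corners_def by blast+
  then have "fst x = fst y \<or> comparable d (fst x) (fst y)"
    using val xy(3) by (simp add: valid_def)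
  then show False
  proof
    assume "fst x = fst y"
    then show False using *(1) by simp
  next
    assume "comparable d (fst x) (fst y)"
    moreover have "i < d" "j < d" using ij k by simp_all
    ultimately have "fst x i < fst y i \<or> fst y j < fst x j"
      unfolding comparable_def below_def by blast
    then show False using * by linarith
  qed
qed

text \<open>The vector \<open>t\<close> separates the bottom points \<open>X\<close> from the top
  points \<open>Y\<close>, so \<open>C a\<close> and \<open>D\<close> join to one chain. In order
  \<open>a\<close> the middle box lies between \<open>lb a\<close> and both \<open>ub a\<close> and
  \<open>t a\<close>: below \<open>C a\<close> and all of \<open>Y\<close>. In the other orders it
  uses the bounds left by the top game: above \<open>X\<close>, and in order \<open>d - 1\<close>
  also above \<open>D\<close>. Thus the orders \<open>a\<close> and \<open>d - 1\<close> together
  make the box incomparable to the whole chain, while the rest of \<open>X\<close> is below it and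
  the rest of \<open>Y\<close> above it.\<close>

lemma middle_box:
  fixes lb ub t lt ut :: vec
  assumes d: "d \<ge> 2" and a: "a < d - 1"
    and bot: "corners d (d - 1) v l u X C lb ub"
    and top: "top_corner d (d - 1) t u Y D lt ut"
    and t_mid: "\<forall>j<d. lb j < t j \<and> t j < u j" and t_above: "\<forall>x\<in>X. \<forall>j<d. fst x j < t j"
    and inY: "\<forall>x\<in>Y. inbox d t u (fst x)"
    and lm_def: "lm = (\<lambda>j. if j = a then lb j else lt j)"
    and um_def: "um = (\<lambda>j. if j = a then min (ub j) (t j) else ut j)"
  shows "subbox d lm um l u" "chain d (C a \<union> D)"
    and "\<And>x. x \<in> C a \<union> D \<Longrightarrow> \<exists>i<d. \<exists>j<d. um i \<le> fst x i \<and> fst x j \<le> lm j"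
    and "\<And>x. x \<in> (Y \<union> X) - (C a \<union> D) \<Longrightarrow>
      (\<forall>j<d. fst x j \<le> lm j) \<or> (\<forall>j<d. um j \<le> fst x j)"
    and "\<And>x j. x \<in> Y \<union> X \<Longrightarrow> j < d \<Longrightarrow> fst x j \<le> lm j \<or> um j \<le> fst x j"
proof -
  have ad: "a < d" "d - 1 < d" "a \<noteq> d - 1" using d a by auto
  have t: "lb j < t j \<and> t j < u j" "x \<in> X \<Longrightarrow> fst x j < t j" if "j < d" for j x
    using t_mid t_above that by simp_all
  have b: "l j \<le> lb j" "lb j < ub j" "ub j \<le> u j" if "j < d" for j
    using bot that by (simp_all add: corners_def subbox_def)
  have tt: "t j \<le> lt j" "lt j < ut j" "ut j \<le> u j" if "j < d" for j
    using top that by (simp_all add: top_corner_def subbox_def)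
  have Ca: "C a \<subseteq> X" "chain d (C a)" "\<And>x. x \<in> C a \<Longrightarrow> at_corner d a lb ub (fst x)"
    using bot a by (simp_all add: corners_def)
  have D: "D \<subseteq> Y" "chain d D" "\<And>x. x \<in> D \<Longrightarrow> fst x (d - 1) \<le> lt (d - 1)"
    "\<And>x j. x \<in> D \<Longrightarrow> j < d \<Longrightarrow> j \<noteq> d - 1 \<Longrightarrow> ut j \<le> fst x j"
    "\<And>x j. x \<in> Y - D \<Longrightarrow> j < d \<Longrightarrow> ut j \<le> fst x j"
    using top by (simp_all add: top_corner_def)
  have Yt: "t j < fst x j" if "x \<in> Y" "j < d" for x j
    using inY that by (simp add: inbox_def)
  show "subbox d lm um l u"
    unfolding subbox_def
  proof (intro allI impI)
    fix j assume j: "j < d"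
    show "l j \<le> lm j \<and> lm j < um j \<and> um j \<le> u j"
      using b[OF j] tt[OF j] t(1)[OF j] by (auto simp: lm_def um_def min_def)
  qed
  show "chain d (C a \<union> D)"
    unfolding chain_def
  proof (intro ballI impI)
    fix x y assume xy: "x \<in> C a \<union> D" "y \<in> C a \<union> D" "fst x \<noteq> fst y"
    then have ne: "fst x \<noteq> fst y" by simp
    have up: "comparable d (fst x) (fst y)" "comparable d (fst y) (fst x)"
      if "x \<in> C a" and "y \<in> D" for x y
    proof -
      have "fst x j < fst y j" if "j < d" for j
        using t(2)[OF that, of x] Yt[OF _ that, of y] Ca(1) D(1) \<open>x \<in> C a\<close> \<open>y \<in> D\<close>
        by (meson less_trans subsetD)
      then show "comparable d (fst x) (fst y)" "comparable d (fst y) (fst x)"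
        by (simp_all add: comparable_def below_def)
    qed
    from xy(1,2) consider "x \<in> C a" "y \<in> C a" | "x \<in> C a" "y \<in> D" | "x \<in> D" "y \<in> C a"
      | "x \<in> D" "y \<in> D" by blast
    then show "comparable d (fst x) (fst y)"
    proof cases
      case 1 then show ?thesis using Ca(2) ne by (simp add: chain_def)
    next
      case 2 then show ?thesis by (rule up)
    next
      case 3 show ?thesis by (rule up(2)[OF 3(2,1)])
    next
      case 4 then show ?thesis using D(2) ne by (simp add: chain_def)
    qed
  qed
  have lm_ge: "fst x j \<le> lm j" if "x \<in> X" "j < d" "j = a \<Longrightarrow> fst x j \<le> lb j" for x j
    using t(2)[OF that(2,1)] tt(1)[OF that(2)] that(3) by (auto simp: lm_def)
  have um_le: "um j \<le> fst x j" if "x \<in> Y" "j < d" "j \<noteq> a \<Longrightarrow> ut j \<le> fst x j" for x j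
    using Yt[OF that(1,2)] that(3) by (auto simp: um_def min_le_iff_disj)
  have Ca_um: "um a \<le> fst x a" if "x \<in> C a" for x
    using Ca(3)[OF that] by (simp add: um_def at_corner_def min_le_iff_disj)
  \<comment> \<open>Each other bottom chain exceeds the box only in its own order, so in order
    \<open>a\<close> it is below.\<close>
  have rest: "fst x a \<le> lb a" if x: "x \<in> X - C a" for x
  proof (cases "\<exists>i<d - 1. x \<in> C i")
    case True
    then obtain i where i: "i < d - 1" "x \<in> C i" by blast
    then have "at_corner d i lb ub (fst x)" using bot by (simp add: corners_def)
    moreover have "i \<noteq> a" using i x by auto
    ultimately show ?thesis using ad by (simp add: at_corner_def)
  next
    case False
    then show ?thesis using bot x ad by (simp add: corners_def)
  qed
  show "\<exists>i<d. \<exists>j<d. um i \<le> fst x i \<and> fst x j \<le> lm j" if "x \<in> C a \<union> D" for x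
  proof (intro exI conjI)
    show "a < d" "d - 1 < d" by fact+
    show "um a \<le> fst x a"
      using that
    proof
      assume "x \<in> D"
      then show ?thesis using um_le[of x a] D(1) ad by blast
    qed (rule Ca_um)
    show "fst x (d - 1) \<le> lm (d - 1)"
      using that
    proof
      assume "x \<in> C a"
      then show ?thesis using lm_ge[of x "d - 1"] Ca(1) ad by blast
    next
      assume "x \<in> D"
      then show ?thesis using D(3) ad by (simp add: lm_def)
    qed
  qed
  have below_mid: "fst x j \<le> lm j" if "x \<in> X - C a" "j < d" for x j
    using lm_ge[of x j] rest[of x] that by blast
  have above_mid: "um j \<le> fst x j" if "x \<in> Y - D" "j < d" for x j
    using um_le[of x j] D(5)[of x j] that by blast
  show "(\<forall>j<d. fst x j \<le> lm j) \<or> (\<forall>j<d. um j \<le> fst x j)"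
    if "x \<in> (Y \<union> X) - (C a \<union> D)" for x
    using that below_mid above_mid by blast
  show "fst x j \<le> lm j \<or> um j \<le> fst x j" if x: "x \<in> Y \<union> X" and j: "j < d" for x j
  proof (cases "x \<in> C a \<union> D")
    case True
    then show ?thesis
    proof
      assume x: "x \<in> C a"
      then show ?thesis using Ca_um[of x] lm_ge[of x j] Ca(1) j by blast
    next
      assume x: "x \<in> D"
      show ?thesis
      proof (cases "j = d - 1")
        case True
        then show ?thesis using D(3)[OF x] ad by (auto simp: lm_def)
      next
        case False
        then show ?thesis using um_le[of x j] D(1,4) x j by blast
      qed
    qed
  next
    case False
    then show ?thesis using below_mid above_mid x j by blast
  qed
qed

section \<open>Counting colors in the recursion\<close>

text \<open>The linear term pays for the \<open>d\<close> colors by which the guaranteed size of a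
  bottom chain falls short of the width at each level. It also makes the target nonpositive for
  \<open>w \<le> d\<close>, which starts the recursion.\<close>

definition target :: "nat \<Rightarrow> nat \<Rightarrow> real" where
  "target d w = (2 - 1 / (real d - 1)) * real ((w + 1) choose 2) - 2 * real d * real w"

lemma target_Suc:
  "target d (Suc w) = target d w + (2 - 1 / (real d - 1)) * (real w + 1) - 2 * real d"
proof -
  have "(Suc w + 1) choose 2 = ((w + 1) choose 2) + (w + 1)"
    by (simp add: numeral_2_eq_2)
  then have "real ((Suc w + 1) choose 2) = real ((w + 1) choose 2) + (real w + 1)"
    by simp
  then show ?thesis unfolding target_def by (simp add: algebra_simps add_divide_distrib)
qed

lemma real_Suc_choose_two: "real ((w + 1) choose 2) = real w * (real w + 1) / 2"
proof -
  have "2 * ((w + 1) choose 2) = w * (w + 1)" by (simp add: choose_two)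
  then show ?thesis
    by (metis (no_types) mult.commute nonzero_mult_div_cancel_left of_nat_1 of_nat_add of_nat_mult
        of_nat_numeral zero_neq_numeral)
qed

lemma target_nonpos:
  assumes "d \<ge> 2" "w \<le> d"
  shows "target d w \<le> 0"
proof -
  have "(2 - 1 / (real d - 1)) * (real w * (real w + 1) / 2) \<le> 2 * (real w * (real w + 1) / 2)"
    using assms(1) by (intro mult_right_mono) auto
  also have "\<dots> \<le> 2 * real d * real w"
  proof -
    have "real w * (real w + 1) \<le> real w * (2 * real d)"
      using assms by (intro mult_left_mono) auto
    then show ?thesis by (simp add: algebra_simps)
  qed
  finally show ?thesis unfolding target_def real_Suc_choose_two by simp
qed

definition game_won :: "nat \<Rightarrow> nat \<Rightarrow> vec \<Rightarrow> vec \<Rightarrow> (vec \<times> nat) list \<Rightarrow> (vec \<times> nat) list \<Rightarrow> bool" where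
  "game_won d w l u st st' \<longleftrightarrow>
     (\<exists>new. st' = new @ st \<and> reached d w l u new \<and> target d w \<le> real (card (snd ` set new)))"

text \<open>Inclusion-exclusion: \<open>F\<close> and \<open>G\<close> are the color sets of the
  bottom and top chain, and the overlap costs at most a fraction \<open>1 / (d - 1)\<close> of
  \<open>G\<close>.\<close>

lemma card_gain:
  assumes "2 \<le> d" "finite F" "finite G" "(d - 1) * card (F \<inter> G) \<le> card G"
    and "Suc w - d \<le> card F" "Suc w \<le> card G" "d \<le> Suc w"
  shows "(2 - 1 / (real d - 1)) * (real w + 1) - 2 * real d \<le> real (card (F \<union> G))"
proof -
  have k: "real (d - 1) = real d - 1" "1 \<le> real d - 1" using assms(1) by auto
  have "card (F \<union> G) + card (F \<inter> G) = card F + card G"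
    using card_Un_Int[OF assms(2,3)] by simp
  then have "real (card (F \<union> G)) = real (card F) + real (card G) - real (card (F \<inter> G))"
    by linarith
  moreover have "real (card (F \<inter> G)) \<le> real (card G) / (real d - 1)"
  proof -
    have "(real d - 1) * real (card (F \<inter> G)) \<le> real (card G)"
      using assms(4) k(1) by (metis of_nat_le_iff of_nat_mult)
    then show ?thesis using k(2) by (simp add: field_simps)
  qed
  \<comment> \<open>The coefficient is nonnegative since \<open>d \<ge> 2\<close>, so a top chain
    with more than \<open>w + 1\<close> colors only helps.\<close>
  moreover have "(1 - 1 / (real d - 1)) * (real w + 1) \<le> (1 - 1 / (real d - 1)) * real (card G)"
    using assms(6) k(2) by (intro mult_left_mono) auto
  moreover have "real w + 1 - real d \<le> real (card F)"
    using assms(5,7) by linarith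
  ultimately show ?thesis by (simp add: algebra_simps add_divide_distrib)
qed

lemma subbox_refl: "subbox d l' u' l u \<Longrightarrow> subbox d l' u' l' u'"
  by (simp add: subbox_def)

lemma reached_mono: "reached d m l u new \<Longrightarrow> m \<le> n \<Longrightarrow> reached d n l u new"
  unfolding reached_def using width_le_mono by blast

lemma game_wonI:
  assumes "reached d w l u new" "target d w \<le> real (card X)" "X \<subseteq> snd ` set new"
  shows "game_won d w l u st (new @ st)"
proof -
  have "card X \<le> card (snd ` set new)" using assms(3) by (intro card_mono) auto
  then have "target d w \<le> real (card (snd ` set new))" using assms(2) by linarith
  then show ?thesis using assms(1) unfolding game_won_def by blast
qed

text \<open>One level plays the bottom points \<open>B\<close>, the top points \<open>T\<close> and
  then recursively \<open>M\<close> in the middle box. The colors of \<open>M\<close> are disjoint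
  from those of the chain \<open>C a \<union> D\<close>, so the gains of the levels add up.\<close>

lemma game_force:
  assumes "d \<ge> 2" "valid d st" "clear d l u st" "subbox d l u l u"
  shows "force d (game_won d w l u st) st"
  using assms(2-4)
proof (induction w arbitrary: st l u)
  case 0
  have "game_won d 0 l u st ([] @ st)"
    by (rule game_wonI[where X = "{}"])
      (use target_nonpos[OF assms(1), of 0] in \<open>simp_all add: reached_def\<close>)
  then show ?case by (simp add: force.stop)
next
  case (Suc w)
  note val = Suc.prems(1) and clr = Suc.prems(2) and box = Suc.prems(3)
  show ?case
  proof (cases "Suc w \<le> d")
    case True
    have "game_won d (Suc w) l u st ([] @ st)"
      by (rule game_wonI[where X = "{}"])
        (use target_nonpos[OF assms(1) True] in \<open>simp_all add: reached_def\<close>)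
    then show ?thesis by (simp add: force.stop)
  next
    case False
    \<comment> \<open>The nested corners need width \<open>v + (d - 1)\<close>, which has to fit
      into \<open>Suc w\<close>.\<close>
    define v where "v = Suc w - d"
    have v: "v + (d - 1) \<le> Suc w" "d \<le> Suc w" using False assms(1) by (auto simp: v_def)
    \<comment> \<open>With \<open>N\<close> colors the target of this level is already met, so each
      escape clause ends the game.\<close>
    define N where "N = nat \<lceil>target d (Suc w)\<rceil>"
    have N: "target d (Suc w) \<le> real m" if "N \<le> m" for m
      using that unfolding N_def by linarith
    have "force d (corners_won d N (d - 1) v l u st) st"
      by (rule corners_force[OF _ assms(1) val clr box]) simp
    then show ?thesis
    proof (rule force_bind[OF _ val])
      fix s1 assume "corners_won d N (d - 1) v l u st s1" and val1: "valid d s1"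
      then obtain B where s1: "s1 = B @ st" and reachB0: "reached d (v + (d - 1)) l u B"
        and wonB: "N \<le> card (snd ` set B) \<or> (\<exists>C l' u'. corners d (d - 1) v l u (set B) C l' u')"
        unfolding corners_won_def by blast
      have reachB: "reached d (Suc w) l u B" using reachB0 v(1) by (rule reached_mono)
      have inB: "inbox d l u (fst x)" if "x \<in> set B" for x
        using reachB that by (simp add: reached_def)
      show "force d (game_won d (Suc w) l u st) s1"
      proof (cases "N \<le> card (snd ` set B)")
        case True
        then show ?thesis unfolding s1 using game_wonI[OF reachB N] by (blast intro: force.stop)
      next
        case False
        then obtain C lb ub where cor: "corners d (d - 1) v l u (set B) C lb ub"
          using wonB by blast
        have subB: "subbox d lb ub l u" using cor by (simp add: corners_def)
        \<comment> \<open>This is the threshold \<open>t\<close>: the top game is played in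
          \<open>(t, u)\<close>, hence above all of \<open>B\<close> and above
          \<open>lb\<close>.\<close>
        have "\<exists>z :: vec. \<forall>j<d. z j < u j \<and> (\<forall>p\<in>insert lb (fst ` set B). p j < z j)"
        proof (rule ex_above)
          fix p j assume p: "p \<in> insert lb (fst ` set B)" and j: "j < d"
          from p show "p j < u j"
          proof
            assume "p = lb"
            moreover have "lb j < ub j" "ub j \<le> u j" using subB j by (simp_all add: subbox_def)
            ultimately show ?thesis by simp
          next
            assume "p \<in> fst ` set B"
            then obtain x where "x \<in> set B" "p = fst x" by blast
            then show ?thesis using inB[of x] j by (simp add: inbox_def)
          qed
        qed simp
        then obtain t :: vec where t: "\<And>j. j < d \<Longrightarrow> lb j < t j \<and> t j < u j"
          "\<And>x j. x \<in> set B \<Longrightarrow> j < d \<Longrightarrow> fst x j < t j" by auto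
        have subT: "subbox d t u l u"
          unfolding subbox_def
        proof (intro allI impI)
          fix j assume j: "j < d"
          have "l j \<le> lb j" using subB j by (simp add: subbox_def)
          then show "l j \<le> t j \<and> t j < u j \<and> u j \<le> u j" using t(1)[OF j] by simp
        qed
        have "force d (top_won d N (d - 1) (Suc w) t u s1) s1"
        proof (rule top_force[OF _ assms(1) val1])
          show "d - 1 < d" using assms(1) by simp
          have "clear d t u B" using t(2) unfolding clear_def by (simp add: less_imp_le)
          then show "clear d t u s1" unfolding s1 clear_append
            using clear_subbox[OF clr subT] by blast
          show "subbox d t u t u" using subT by (rule subbox_refl)
        qed
        then show ?thesis
        proof (rule force_bind[OF _ val1])
          fix s2 assume "top_won d N (d - 1) (Suc w) t u s1 s2" and val2: "valid d s2"
          then obtain T where s2: "s2 = (T @ B) @ st" and reachT: "reached d (Suc w) t u T"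
            and wonT: "N \<le> card (snd ` set T) \<or>
              (\<exists>D l' u'. top_corner d (d - 1) t u (set T) D l' u' \<and> Suc w \<le> card (snd ` D))"
            unfolding top_won_def s1 append_assoc by blast
          have inT: "inbox d t u (fst x)" if "x \<in> set T" for x
            using reachT that by (simp add: reached_def)
          have reachTB: "reached d (Suc w) l u (T @ B)"
          \<comment> \<open>Every top point is above every bottom point, so \<open>K\<close> is
            empty and the top game may use the full width.\<close>
          proof (rule reached_append[OF reachB subT reachT, where K = "{}" and k = 0])
            fix x p assume "x \<in> set B - {}" "inbox d t u p"
            then show "comparable d p (fst x)"
              using comparable_inbox_below[of d t u p "fst x"] t(2)[of x] by (simp add: less_imp_le)
          qed simp_all
          show "force d (game_won d (Suc w) l u st) s2"
          proof (cases "N \<le> card (snd ` set T)")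
            case True
            have "snd ` set T \<subseteq> snd ` set (T @ B)" by auto
            then show ?thesis unfolding s2 using game_wonI[OF reachTB N[OF True]]
              by (blast intro: force.stop)
          next
            case False
            then obtain D lt ut where top: "top_corner d (d - 1) t u (set T) D lt ut"
              and cardD: "Suc w \<le> card (snd ` D)" using wonT by blast
            have subD: "D \<subseteq> set T" using top by (simp add: top_corner_def)
            have finD: "finite (snd ` D)" using subD finite_subset by blast
            \<comment> \<open>The order \<open>a\<close> is chosen only now, when the colors of the
              top chain are known.\<close>
            have "\<exists>a<d - 1. (d - 1) * card (snd ` C a \<inter> snd ` D) \<le> card (snd ` D)"
            proof (rule ex_small_inter[OF finD])
              show "0 < d - 1" using assms(1) by simp
              fix i j assume ij: "i < d - 1" "j < d - 1" "i \<noteq> j"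
              have "valid d (T @ B @ st)" using val2 by (simp add: s2)
              from corners_disjoint_colors[OF cor _ this ij] show "snd ` C i \<inter> snd ` C j = {}"
                by simp
            qed
            then obtain a where a: "a < d - 1"
              "(d - 1) * card (snd ` C a \<inter> snd ` D) \<le> card (snd ` D)" by blast
            have subC: "C a \<subseteq> set B" and cardC: "v \<le> card (snd ` C a)"
              using cor a(1) by (simp_all add: corners_def)
            have finC: "finite (snd ` C a)" using subC finite_subset by blast
            define lm where "lm = (\<lambda>j. if j = a then lb j else lt j)"
            define um where "um = (\<lambda>j. if j = a then min (ub j) (t j) else ut j)"
            have "\<forall>j<d. lb j < t j \<and> t j < u j" "\<forall>x\<in>set B. \<forall>j<d. fst x j < t j"
              "\<forall>x\<in>set T. inbox d t u (fst x)"
              using t inT by simp_all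
            note mid = middle_box[OF assms(1) a(1) cor top this lm_def um_def]
            have "force d (game_won d w lm um s2) s2"
            proof (rule Suc.IH[OF val2])
              have "clear d lm um (T @ B)"
                unfolding clear_def set_append using mid(5) by blast
              then show "clear d lm um s2"
                unfolding s2 clear_append[of d lm um "T @ B"] using clear_subbox[OF clr mid(1)] by blast
              show "subbox d lm um lm um" using mid(1) by (rule subbox_refl)
            qed
            then show ?thesis
            proof (rule force_bind[OF _ val2], intro force.stop)
              fix s3 assume "game_won d w lm um s2 s3" and val3: "valid d s3"
              then obtain M where s3: "s3 = (M @ T @ B) @ st" and reachM: "reached d w lm um M"
                and cardM: "target d w \<le> real (card (snd ` set M))"
                unfolding game_won_def s2 append_assoc by blast
              have reach: "reached d (Suc w) l u (M @ T @ B)"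
              \<comment> \<open>Only the single chain \<open>C a \<union> D\<close> is incomparable
                to the middle box, so width \<open>w\<close> there gives \<open>w + 1\<close>
                overall.\<close>
              proof (rule reached_append[OF reachTB mid(1) reachM])
                show "width_le d (fst ` (C a \<union> D)) 1" using mid(2) by (rule width_le_fst_chain)
                show "C a \<union> D \<subseteq> set (T @ B)" using subC subD by auto
                fix x p assume x: "x \<in> set (T @ B) - (C a \<union> D)" and p: "inbox d lm um p"
                from x have "(\<forall>j<d. fst x j \<le> lm j) \<or> (\<forall>j<d. um j \<le> fst x j)"
                  unfolding set_append by (rule mid(4))
                then show "comparable d p (fst x)"
                  using comparable_inbox_below[OF p] comparable_inbox_above[OF p] by blast
              qed simp
              have disj: "snd ` set M \<inter> (snd ` C a \<union> snd ` D) = {}"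
              proof (rule ccontr)
                assume "snd ` set M \<inter> (snd ` C a \<union> snd ` D) \<noteq> {}"
                then obtain x y where x: "x \<in> set M" and y: "y \<in> C a \<union> D" and eq: "snd x = snd y"
                  by (auto simp: image_iff)
                from mid(3)[OF y] obtain i j where ij: "i < d" "j < d" "um i \<le> fst y i" "fst y j \<le> lm j"
                  by blast
                have "inbox d lm um (fst x)" using reachM x by (simp add: reached_def)
                from incomparable_inbox[OF this ij]
                have "\<not> comparable d (fst x) (fst y)" "fst x \<noteq> fst y" .
                moreover have "x \<in> set s3" "y \<in> set s3"
                  using x y subC subD by (auto simp: s3)
                ultimately show False using val3 eq unfolding valid_def by blast
              qed
              have "target d (Suc w) \<le> target d w + real (card (snd ` C a \<union> snd ` D))"
                using card_gain[OF assms(1) finC finD a(2) _ cardD v(2)] cardC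
                by (simp add: v_def target_Suc)
              also have "\<dots> \<le> real (card (snd ` set M)) + real (card (snd ` C a \<union> snd ` D))"
                using cardM by simp
              also have "\<dots> = real (card (snd ` set M \<union> (snd ` C a \<union> snd ` D)))"
                using card_Un_disjoint[OF _ _ disj] finC finD by simp
              finally have "target d (Suc w) \<le> real (card (snd ` set M \<union> (snd ` C a \<union> snd ` D)))" .
              moreover have "snd ` set M \<union> (snd ` C a \<union> snd ` D) \<subseteq> snd ` set (M @ T @ B)"
                using subC subD unfolding set_append by blast
              ultimately show "game_won d (Suc w) l u st s3"
                unfolding s3 using game_wonI[OF reach] by blast
            qed
          qed
        qed
      qed
    qed
  qed
qed

section \<open>From forcing to strategies\<close>

text \<open>Replies are listed in chronological order while positions put the latest point first;
  \<open>g\<close> sees only the replies given after \<open>st\<close>.\<close>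

primrec run :: "(vec \<times> nat) list \<Rightarrow> (nat list \<Rightarrow> vec) \<Rightarrow> nat list \<Rightarrow> (vec \<times> nat) list" where
  "run st g [] = st"
| "run st g (c # cs) = run ((g [], c) # st) (\<lambda>r. g (c # r)) cs"

lemma run_append: "run st g (cs @ [c]) = (g cs, c) # run st g cs"
  by (induction cs arbitrary: st g) simp_all

text \<open>Illegal replies are covered too, because \<open>anna_strategy\<close> demands a realizer
  for every list of colors.\<close>

definition always_fresh :: "nat \<Rightarrow> (vec \<times> nat) list \<Rightarrow> (nat list \<Rightarrow> vec) \<Rightarrow> bool" where
  "always_fresh d st g \<longleftrightarrow> (\<forall>cs. fresh d (run st g cs) (g cs))"

text \<open>An illegal reply also counts as a win, but only with the width bound after it: an
  on-line partitioner is required to be correct only up to width \<open>w\<close>.\<close>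

definition wins ::
  "nat \<Rightarrow> nat \<Rightarrow> ((vec \<times> nat) list \<Rightarrow> bool) \<Rightarrow> (vec \<times> nat) list \<Rightarrow> (nat list \<Rightarrow> vec) \<Rightarrow> bool" where
  "wins d w Q st g \<longleftrightarrow> (\<forall>\<chi>. \<exists>n. Q (run st g (map \<chi> [0..<n])) \<or>
     (\<not> legal d (run st g (map \<chi> [0..<n])) (g (map \<chi> [0..<n])) (\<chi> n) \<and>
      width_le d (fst ` set (run st g (map \<chi> [0..<Suc n]))) w))"

lemma ex_fresh: "\<exists>p. fresh d st p"
proof -
  have "\<exists>z. \<forall>x\<in>set st. z \<noteq> fst x j" for j
    using ex_new_if_finite[OF infinite_UNIV_char_0, of "(\<lambda>x. fst x j) ` set st"] by auto
  then obtain p where "\<forall>j. \<forall>x\<in>set st. p j \<noteq> fst x j" by metis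
  then show ?thesis unfolding fresh_def by blast
qed

text \<open>Provides an arbitrary continuation for plays that are already decided.\<close>

lemma ex_always_fresh: "\<exists>g. always_fresh d st g"
proof -
  define p where "p s = (SOME p. fresh d s p)" for s
  define s where "s cs = foldl (\<lambda>s c. (p s, c) # s) st cs" for cs
  have "run st (\<lambda>cs. p (s cs)) cs = s cs" for cs
    by (induction cs rule: rev_induct) (simp_all add: run_append s_def)
  moreover have "fresh d s (p s)" for s
    unfolding p_def using ex_fresh by (rule someI_ex)
  ultimately have "always_fresh d st (\<lambda>cs. p (s cs))" by (simp add: always_fresh_def)
  then show ?thesis by (intro exI)
qed

text \<open>The derivation of \<open>force\<close> is unfolded into a function: the first reply
  selects the strategy of the matching subtree, or any fresh continuation if that reply is
  illegal.\<close>

lemma force_strategy: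
  assumes "force d Q st" and Q: "\<And>s. Q s \<Longrightarrow> width_le d (fst ` set s) w"
  shows "\<exists>g. always_fresh d st g \<and> wins d w Q st g"
  using assms(1)
proof induction
  case (stop st)
  obtain g where "always_fresh d st g" using ex_always_fresh by blast
  moreover have "wins d w Q st g"
    unfolding wins_def using stop by (intro allI exI[of _ 0]) simp
  ultimately show ?case by blast
next
  case (move st p)
  have "\<exists>g. always_fresh d ((p, c) # st) g \<and> (legal d st p c \<longrightarrow> wins d w Q ((p, c) # st) g)" for c
    using move.IH[of c] ex_always_fresh[of d "(p, c) # st"] by blast
  then obtain G where G: "\<And>c. always_fresh d ((p, c) # st) (G c)"
    "\<And>c. legal d st p c \<Longrightarrow> wins d w Q ((p, c) # st) (G c)" by metis
  define g where "g cs = (case cs of [] \<Rightarrow> p | c # r \<Rightarrow> G c r)" for cs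
  have g: "g [] = p" "g (c # r) = G c r" for c r by (simp_all add: g_def)
  have run: "run st g (c # cs) = run ((p, c) # st) (G c) cs" for c cs
    by (simp add: g)
  have "always_fresh d st g"
    unfolding always_fresh_def
  proof
    fix cs show "fresh d (run st g cs) (g cs)"
    proof (cases cs)
      case Nil
      then show ?thesis using move.hyps(1) by (simp add: g)
    next
      case (Cons c r)
      then show ?thesis using G(1)[of c] unfolding always_fresh_def Cons run g(2) by blast
    qed
  qed
  moreover have "wins d w Q st g"
    unfolding wins_def
  proof
    fix \<chi> :: "nat \<Rightarrow> nat"
    have map: "map \<chi> [0..<Suc n] = \<chi> 0 # map (\<lambda>i. \<chi> (Suc i)) [0..<n]" for n
      by (simp add: map_upt_Suc del: upt_Suc)
    show "\<exists>n. Q (run st g (map \<chi> [0..<n])) \<or>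
     (\<not> legal d (run st g (map \<chi> [0..<n])) (g (map \<chi> [0..<n])) (\<chi> n) \<and>
      width_le d (fst ` set (run st g (map \<chi> [0..<Suc n]))) w)" (is "\<exists>n. ?P n")
    proof (cases "legal d st p (\<chi> 0)")
      case True
      let ?\<chi> = "\<lambda>i. \<chi> (Suc i)" and ?G = "G (\<chi> 0)" and ?st = "(p, \<chi> 0) # st"
      obtain n where "Q (run ?st ?G (map ?\<chi> [0..<n])) \<or>
        (\<not> legal d (run ?st ?G (map ?\<chi> [0..<n])) (?G (map ?\<chi> [0..<n])) (?\<chi> n) \<and>
         width_le d (fst ` set (run ?st ?G (map ?\<chi> [0..<Suc n]))) w)"
        using G(2)[OF True] unfolding wins_def by metis
      then have "?P (Suc n)" unfolding map run g(2) .
      then show ?thesis by (intro exI)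
    next
      case False
      \<comment> \<open>Width depends on the points only, so replacing the illegal color by a legal
        one gives the bound.\<close>
      obtain c where "legal d st p c" using ex_legal by blast
      then have "width_le d (fst ` set ((p, c) # st)) w"
        using force_width[OF move.hyps(2) Q] by blast
      then have "?P 0" using False by (simp add: g)
      then show ?thesis by (intro exI)
    qed
  qed
  ultimately show ?case by blast
qed

section \<open>Lists of vectors as realizers\<close>

definition position :: "nat \<Rightarrow> vec list \<Rightarrow> nat rel list" where
  "position d ps =
     map (\<lambda>j. {(x, y). x < length ps \<and> y < length ps \<and> (ps ! x) j \<le> (ps ! y) j}) [0..<d]"

text \<open>Distinct coordinates are what makes the coordinatewise comparisons antisymmetric on
  indices.\<close>

definition generic :: "nat \<Rightarrow> vec list \<Rightarrow> bool" where
  "generic d ps \<longleftrightarrow> (\<forall>x<length ps. \<forall>y<length ps. x \<noteq> y \<longrightarrow> (\<forall>j<d. (ps ! x) j \<noteq> (ps ! y) j))"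

lemma generic_snoc:
  assumes "generic d ps" "\<And>q j. q \<in> set ps \<Longrightarrow> j < d \<Longrightarrow> p j \<noteq> q j"
  shows "generic d (ps @ [p])"
  unfolding generic_def
proof (intro allI impI)
  fix x y j assume xy: "x < length (ps @ [p])" "y < length (ps @ [p])" "x \<noteq> y" and j: "j < d"
  have neq: "p j \<noteq> (ps ! i) j" if "i < length ps" for i
    using assms(2)[OF nth_mem[OF that] j] .
  have less: "i < length ps \<or> i = length ps" if "i < length (ps @ [p])" for i
    using that by auto
  from less[OF xy(1)] less[OF xy(2)] show "((ps @ [p]) ! x) j \<noteq> ((ps @ [p]) ! y) j"
  proof (elim disjE)
    assume "x < length ps" "y < length ps"
    then show ?thesis using assms(1) xy(3) j by (simp add: generic_def nth_append)
  next
    assume "x < length ps" "y = length ps"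
    then show ?thesis using neq[of x] by (simp add: nth_append)
  next
    assume "x = length ps" "y < length ps"
    then show ?thesis using neq[of y] by (simp add: nth_append)
  next
    assume "x = length ps" "y = length ps"
    then show ?thesis using xy(3) by simp
  qed
qed

lemma realizer_position:
  assumes "generic d ps"
  shows "realizer d (length ps) (position d ps)"
  unfolding realizer_def
proof (intro conjI ballI)
  show "length (position d ps) = d" by (simp add: position_def)
  fix L assume "L \<in> set (position d ps)"
  then obtain j where j: "j < d"
    and L: "L = {(x, y). x < length ps \<and> y < length ps \<and> (ps ! x) j \<le> (ps ! y) j}"
    unfolding position_def by auto
  have "x = y" if "(x, y) \<in> L" "(y, x) \<in> L" for x y
  proof (rule ccontr)
    assume "x \<noteq> y"
    moreover have "x < length ps" "y < length ps" "(ps ! x) j = (ps ! y) j"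
      using that by (simp_all add: L)
    ultimately show False using assms j unfolding generic_def by blast
  qed
  then have "antisym L" by (rule antisymI)
  moreover have "refl_on {..<length ps} L" by (auto simp: refl_on_def L)
  moreover have "trans L" by (auto simp: trans_def L)
  moreover have "total_on {..<length ps} L" by (auto simp: total_on_def L)
  ultimately show "linear_order_on {..<length ps} L"
    by (auto simp: order_on_defs L)
qed

lemma restrict_position:
  "restrict_realizer (length ps) (position d (ps @ qs)) = position d ps"
  unfolding restrict_realizer_def position_def by (auto simp: nth_append)

text \<open>For \<open>d = 0\<close> the intersection over the empty list would be the universal
  relation.\<close>

lemma realized_position:
  assumes "d > 0"
  shows "(x, y) \<in> realized_poset (position d ps) \<longleftrightarrow>
    x < length ps \<and> y < length ps \<and> (\<forall>j<d. (ps ! x) j \<le> (ps ! y) j)"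
  using assms by (auto simp: realized_poset_def position_def)

text \<open>Strictly smaller vectors are related in the realized poset, so an antichain of indices
  gives an antichain of vectors; genericity in order 0 keeps its size.\<close>

lemma poset_width_position:
  assumes "generic d ps" "d > 0" "width_le d (set ps) w"
  shows "poset_width {..<length ps} (realized_poset (position d ps)) \<le> w"
  unfolding poset_width_def
proof (rule Max.boundedI)
  let ?R = "realized_poset (position d ps)"
  have "antichains {..<length ps} ?R \<subseteq> Pow {..<length ps}" by (auto simp: antichains_def)
  then show "finite (card ` antichains {..<length ps} ?R)"
    by (meson finite_Pow_iff finite_imageI finite_lessThan finite_subset)
  have "{} \<in> antichains {..<length ps} ?R" by (simp add: antichains_def)
  then show "card ` antichains {..<length ps} ?R \<noteq> {}" by blast
  fix c assume "c \<in> card ` antichains {..<length ps} ?R"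
  then obtain C where c: "c = card C" and C: "C \<subseteq> {..<length ps}"
    "\<And>x y. x \<in> C \<Longrightarrow> y \<in> C \<Longrightarrow> x \<noteq> y \<Longrightarrow> (x, y) \<notin> ?R"
    by (auto simp: antichains_def)
  have ne: "ps ! x \<noteq> ps ! y" if "x \<in> C" "y \<in> C" "x \<noteq> y" for x y
  proof -
    have "x < length ps" "y < length ps" using that C(1) by auto
    then have "(ps ! x) 0 \<noteq> (ps ! y) 0"
      using assms(1,2) that(3) unfolding generic_def by blast
    then show ?thesis by auto
  qed
  have "card ((!) ps ` C) \<le> w"
  proof (rule width_leD[OF assms(3)])
    show "(!) ps ` C \<subseteq> set ps" using C(1) by auto
    fix p q assume "p \<in> (!) ps ` C" "q \<in> (!) ps ` C" and pq: "p \<noteq> q"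
    then obtain x y where xy: "x \<in> C" "y \<in> C" "p = ps ! x" "q = ps ! y" by (elim imageE)
    then have "x \<noteq> y" using pq by blast
    then have "(x, y) \<notin> ?R" "(y, x) \<notin> ?R" using C(2) xy by simp_all
    moreover have "x < length ps" "y < length ps" using xy C(1) by auto
    ultimately show "\<not> comparable d p q"
      unfolding realized_position[OF assms(2)] comparable_def below_def xy(3,4)
      using less_imp_le by blast
  qed
  moreover have "inj_on ((!) ps) C"
    by (rule inj_onI) (use ne in blast)
  ultimately show "c \<le> w" by (simp add: card_image c)
qed

text \<open>The final entry is the point still awaiting its color, so there is one point more than
  there are replies.\<close>

definition points :: "(nat list \<Rightarrow> vec) \<Rightarrow> nat list \<Rightarrow> vec list" where
  "points g cs = rev (map fst (run [] g cs)) @ [g cs]"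

lemma points_snoc: "points g (cs @ [c]) = points g cs @ [g (cs @ [c])]"
  by (simp add: points_def run_append)

lemma length_points: "length (points g cs) = Suc (length cs)"
proof (induction cs rule: rev_induct)
  case Nil
  show ?case by (simp add: points_def)
qed (simp add: points_snoc)

lemma generic_points:
  assumes "always_fresh d [] g"
  shows "generic d (points g cs)"
proof -
  have step: "generic d (points g cs)" if "generic d (rev (map fst (run [] g cs)))" for cs
    unfolding points_def
  proof (rule generic_snoc[OF that])
    fix q j assume "q \<in> set (rev (map fst (run [] g cs)))" and j: "j < d"
    then obtain x where "x \<in> set (run [] g cs)" "q = fst x" by auto
    then show "g cs j \<noteq> q j"
      using assms j unfolding always_fresh_def fresh_def by blast
  qed
  have "generic d (rev (map fst (run [] g cs)))"
  proof (induction cs rule: rev_induct)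
    case Nil
    show ?case by (simp add: generic_def)
  next
    case (snoc c cs)
    from step[OF snoc] show ?case by (simp add: run_append points_def)
  qed
  then show ?thesis by (rule step)
qed

lemma run_map:
  "rev (run [] g (map \<chi> [0..<n])) = map (\<lambda>i. (g (map \<chi> [0..<i]), \<chi> i)) [0..<n]"
  by (induction n) (simp_all add: run_append)

lemma points_map: "points g (map \<chi> [0..<n]) = map (\<lambda>i. g (map \<chi> [0..<i])) [0..<Suc n]"
proof -
  have "rev (map fst (run [] g (map \<chi> [0..<n]))) = map fst (rev (run [] g (map \<chi> [0..<n])))"
    by (simp add: rev_map)
  then show ?thesis unfolding points_def run_map by (simp add: comp_def)
qed

text \<open>Transfers the coordinate game to the official one: a correct algorithm \<open>A\<close>
  produces some reply sequence \<open>\<chi>\<close>, and an illegal reply in it would contradict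
  its correctness.\<close>

lemma force_imp_forces_chains:
  assumes d: "d > 0" and k: "k > 0"
    and force: "force d (\<lambda>s. width_le d (fst ` set s) w \<and> k \<le> card (snd ` set s)) []"
  shows "\<exists>S. anna_strategy d S \<and> forces_chains w d S k"
proof -
  define Q where "Q = (\<lambda>s. width_le d (fst ` set s) w \<and> k \<le> card (snd ` set (s :: (vec \<times> nat) list)))"
  have "force d Q []" using force by (simp add: Q_def)
  then have "\<exists>g. always_fresh d [] g \<and> wins d w Q [] g"
    by (rule force_strategy) (simp add: Q_def)
  then obtain g where fresh: "always_fresh d [] g" and win: "wins d w Q [] g" by blast
  define S where "S cs = position d (points g cs)" for cs
  have "anna_strategy d S"
    unfolding anna_strategy_def
  proof (intro conjI allI)
    fix cs show "realizer d (Suc (length cs)) (S cs)"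
      using realizer_position[OF generic_points[OF fresh], of cs]
      by (simp add: S_def length_points)
    fix c show "restrict_realizer (Suc (length cs)) (S (cs @ [c])) = S cs"
      unfolding S_def points_snoc length_points[symmetric, of cs g] by (rule restrict_position)
  qed
  moreover have "forces_chains w d S k"
    unfolding forces_chains_def
  proof (intro allI impI)
    fix A assume A: "online_chain_partitioner w d A"
    define \<chi> where "\<chi> n = A (S (play_colors S A n))" for n
    define P where "P i = g (map \<chi> [0..<i])" for i
    have pc: "play_colors S A n = map \<chi> [0..<n]" for n
      by (induction n) (simp_all add: \<chi>_def)
    have pts: "points g (map \<chi> [0..<n]) = map P [0..<Suc n]" for n
      unfolding points_map P_def ..
    have gen: "generic d (map P [0..<Suc n])" for n
      using generic_points[OF fresh, of "map \<chi> [0..<n]"] by (simp only: pts)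
    have run_set: "set (run [] g (map \<chi> [0..<n])) = (\<lambda>i. (P i, \<chi> i)) ` {..<n}" for n
    proof -
      have "set (run [] g (map \<chi> [0..<n])) = set (rev (run [] g (map \<chi> [0..<n])))" by simp
      then show ?thesis unfolding run_map P_def by (simp add: atLeast0LessThan)
    qed
    have width: "poset_width {..<Suc n} (realized_poset (S (play_colors S A n))) \<le> w"
      if "width_le d (fst ` set (run [] g (map \<chi> [0..<Suc n]))) w" for n
    proof -
      have "width_le d (set (map P [0..<Suc n])) w"
        using that unfolding run_set by (simp add: image_image atLeast0LessThan del: upt_Suc)
      from poset_width_position[OF gen d this] show ?thesis
        unfolding S_def pc pts by (simp del: upt_Suc)
    qed
    obtain n where n: "Q (run [] g (map \<chi> [0..<n])) \<or>
        (\<not> legal d (run [] g (map \<chi> [0..<n])) (g (map \<chi> [0..<n])) (\<chi> n) \<and>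
         width_le d (fst ` set (run [] g (map \<chi> [0..<Suc n]))) w)"
      using win unfolding wins_def by metis
    from n show "\<exists>n. poset_width {..<Suc n} (realized_poset (S (play_colors S A n))) \<le> w \<and>
             k \<le> card (set (play_colors S A (Suc n)))"
    proof
      assume Qn: "Q (run [] g (map \<chi> [0..<n]))"
      \<comment> \<open>The official game is judged after at least one round; \<open>k > 0\<close>
        excludes a win at the empty position.\<close>
      then have "n \<noteq> 0" using k by (intro notI) (simp add: Q_def)
      then obtain m where m: "n = Suc m" by (cases n) auto
      have "snd ` set (run [] g (map \<chi> [0..<n])) = set (play_colors S A (Suc m))"
        unfolding run_set pc m by (simp add: image_image atLeast0LessThan del: upt_Suc)
      then have "k \<le> card (set (play_colors S A (Suc m)))"
        using Qn by (simp add: Q_def)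
      moreover have "poset_width {..<Suc m} (realized_poset (S (play_colors S A m))) \<le> w"
        using Qn m by (intro width) (simp add: Q_def del: upt_Suc)
      ultimately show ?thesis by blast
    next
      assume ill: "\<not> legal d (run [] g (map \<chi> [0..<n])) (g (map \<chi> [0..<n])) (\<chi> n) \<and>
         width_le d (fst ` set (run [] g (map \<chi> [0..<Suc n]))) w"
      let ?R = "realized_poset (S (play_colors S A n))"
      have S_n: "S (play_colors S A n) = position d (map P [0..<Suc n])" for n
        unfolding S_def pc pts ..
      \<comment> \<open>Restricting to the first \<open>Suc x\<close> points recovers the position
        in which \<open>x\<close> was colored.\<close>
      have color: "online_color A (S (play_colors S A n)) x = \<chi> x" if "x < Suc n" for x
      proof -
        have "map P [0..<Suc n] = map P [0..<Suc x] @ map P [Suc x..<Suc n]"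
          using that by (metis map_append upt_add_eq_append le_add_diff_inverse Suc_leI zero_le)
        then have "restrict_realizer (length (map P [0..<Suc x])) (S (play_colors S A n)) =
            S (play_colors S A x)"
          unfolding S_n by (simp only: restrict_position)
        then show ?thesis unfolding online_color_def \<chi>_def by (simp del: upt_Suc)
      qed
      have "realizer d (Suc n) (S (play_colors S A n))"
        using realizer_position[OF gen, of n] unfolding S_n by (simp del: upt_Suc)
      moreover have "poset_width {..<Suc n} ?R \<le> w" using ill width by blast
      ultimately have same_color: "{x. x < Suc n \<and> online_color A (S (play_colors S A n)) x = \<chi> n} \<in> Chains ?R"
        using A unfolding online_chain_partitioner_def by blast
      obtain i where i: "i < n" "\<chi> i = \<chi> n" "\<not> comparable d (P n) (P i)"
        using ill unfolding legal_def run_set P_def[symmetric] by auto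
      have "(i, n) \<in> ?R \<or> (n, i) \<in> ?R"
        using same_color i color[of i] color[of n] unfolding Chains_def by auto
      then have le: "(\<forall>j<d. P i j \<le> P n j) \<or> (\<forall>j<d. P n j \<le> P i j)"
        unfolding S_n realized_position[OF d] using i(1) by (simp del: upt_Suc)
      \<comment> \<open>Genericity turns the weak inequalities of the realized poset into strict
        ones, against the illegality of the reply.\<close>
      have "P i j \<noteq> P n j" if "j < d" for j
      proof -
        have "(map P [0..<Suc n] ! i) j \<noteq> (map P [0..<Suc n] ! n) j"
          using gen[of n] i(1) that unfolding generic_def by (simp del: upt_Suc)
        then show ?thesis using i(1) by (simp del: upt_Suc)
      qed
      with le have "comparable d (P n) (P i)"
        unfolding comparable_def below_def by (metis order_le_less)
      with i(3) show ?thesis by contradiction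
    qed
  qed
  ultimately show ?thesis by blast
qed

section \<open>The asymptotic bound\<close>

lemma target_le_olw_R:
  assumes "d \<ge> 2"
  shows "ereal (target d w) \<le> ereal_of_enat (olw_R w d)"
proof (cases "target d w \<le> 0")
  case True
  then have "ereal (target d w) \<le> 0" by simp
  also have "\<dots> \<le> ereal_of_enat (olw_R w d)" by simp
  finally show ?thesis .
next
  case False
  define k where "k = nat \<lceil>target d w\<rceil>"
  \<comment> \<open>The game starts on the empty position in the open unit cube.\<close>
  have "force d (game_won d w (\<lambda>_. 0) (\<lambda>_. 1) []) []"
    using assms by (intro game_force) (simp_all add: valid_def clear_def subbox_def)
  then have "force d (\<lambda>s. width_le d (fst ` set s) w \<and> k \<le> card (snd ` set s)) []"
  proof (rule force_bind)
    show "valid d []" by (simp add: valid_def)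
    fix s assume "game_won d w (\<lambda>_. 0) (\<lambda>_. 1) [] s"
    then have "width_le d (fst ` set s) w" "target d w \<le> real (card (snd ` set s))"
      by (auto simp: game_won_def reached_def)
    moreover from this have "k \<le> card (snd ` set s)"
      unfolding k_def by (simp add: nat_le_iff ceiling_le_iff)
    ultimately show "force d (\<lambda>s. width_le d (fst ` set s) w \<and> k \<le> card (snd ` set s)) s"
      by (intro force.stop) simp
  qed
  moreover have "k > 0" using False by (simp add: k_def)
  ultimately have "\<exists>S. anna_strategy d S \<and> forces_chains w d S k"
    using assms by (intro force_imp_forces_chains) simp_all
  then have "enat k \<le> olw_R w d"
    unfolding olw_R_def by (intro Sup_upper) simp
  then have "ereal_of_enat (enat k) \<le> ereal_of_enat (olw_R w d)"
    by (simp only: ereal_of_enat_le_iff)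
  moreover have "ereal (target d w) \<le> ereal_of_enat (enat k)"
    using False by (simp add: k_def)
  ultimately show ?thesis by (rule order_trans[rotated])
qed

theorem theorem1p2:
  fixes d :: nat
  assumes "d \<ge> 2"
  shows "\<exists>f :: nat \<Rightarrow> real. f \<longlonglongrightarrow> 0 \<and>
    (\<forall>w::nat. w \<ge> 1 \<longrightarrow>
       ereal_of_enat (olw_R w d) \<ge>
       ereal ((2 - 1 / (real d - 1) - f w) * real ((w + 1) choose 2)))"
proof (intro exI conjI allI impI)
  \<comment> \<open>The error is the linear loss \<open>2 * d * w\<close> divided by
    \<open>w * (w + 1) / 2\<close>.\<close>
  let ?f = "\<lambda>w. 4 * real d * inverse (real (Suc w))"
  have "(\<lambda>w. 4 * real d * inverse (real (Suc w))) \<longlonglongrightarrow> 4 * real d * 0"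
    by (intro tendsto_mult tendsto_const LIMSEQ_inverse_real_of_nat)
  then show "?f \<longlonglongrightarrow> 0" by simp
  fix w :: nat
  have "?f w * real ((w + 1) choose 2) = 2 * real d * real w"
    unfolding real_Suc_choose_two by (simp add: field_simps)
  then have "(2 - 1 / (real d - 1) - ?f w) * real ((w + 1) choose 2) = target d w"
    unfolding target_def by (simp add: left_diff_distrib)
  then show "ereal ((2 - 1 / (real d - 1) - ?f w) * real ((w + 1) choose 2)) \<le> ereal_of_enat (olw_R w d)"
    using target_le_olw_R[OF assms] by simp
qed

end
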